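(* Fix any constant deletion rate $0<\delta<1$. There is an SQ algorithm for worst-case trace reconstruction of $n$-bit strings that makes only $O(n^{1/5}\log^5 n)$-local queries, each with tolerance $\tau = 2^{-O(n^{1/5}\log^5 n)}$ (the implied constants depending only on $\delta$).
   Context: Trace reconstruction: fix a deletion rate $\delta\in(0,1)$. For a source string $x=(x_0,\dots,x_{n-1})\in\{0,1\}^n$, a random trace $\mathbf y\sim \mathrm{Del}_\delta(x)$ is obtained by deleting each bit of $x$ independently with probability $\delta$ and concatenating the surviving bits. Each trace is padded with a suffix of zeros to length $n$, so $\mathbf y_i$ is defined for every $i$. An SQ oracle for $x$ takes a query function $q:\{0,1\}^n\to[-1,1]$ and a tolerance $\tau\in(0,1)$ and returns some value within $\tau$ of $\mathbb E_{\mathbf y\sim \mathrm{Del}_\delta(x)}[q(\mathbf y)]$. A query $q$ is $\ell$-local if $q(y)=q'(y_i,\dots,y_{i+\ell-1})$ for some index $i$ and some $q':\{0,1\}^\ell\to[-1,1]$. An SQ algorithm solves worst-case trace reconstruction if for every $x\in\{0,1\}^n$ and every valid sequence of oracle responses it outputs $x$. Here $\log$ is base 2. *)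

theory Defs
  imports "HOL-Probability.Probability" "HOL-Probability.Product_PMF" "HOL-Library.Landau_Symbols"
begin

text \<open>
  Bit strings are lists over \<^typ>\<open>bool\<close>, where \<^term>\<open>False\<close> is the bit 0.
\<close>

definition zero_pad :: "nat \<Rightarrow> bool list \<Rightarrow> bool list" where
  "zero_pad n y = y @ replicate (n - length y) False"

text \<open>
  The random function \<open>keep\<close> marks the surviving positions. The trace is already padded to the
  length of the source string.
\<close>

definition Del :: "real \<Rightarrow> bool list \<Rightarrow> bool list pmf" where
  "Del \<delta> x =
     map_pmf (\<lambda>keep. zero_pad (length x) (nths x {i. keep i}))
       (Pi_pmf {..<length x} False (\<lambda>_. bernoulli_pmf (1 - \<delta>)))"

definition sq_response :: "real \<Rightarrow> bool list \<Rightarrow> (bool list \<Rightarrow> real) \<Rightarrow> real \<Rightarrow> real \<Rightarrow> bool" where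
  "sq_response \<delta> x q \<tau> v \<longleftrightarrow> \<bar>v - measure_pmf.expectation (Del \<delta> x) q\<bar> \<le> \<tau>"

text \<open>
  An adaptive algorithm is a decision tree branching on the real-valued oracle responses.
  The datatype is well-founded, so every sequence of responses leads to an output after finitely
  many queries.
\<close>

datatype sq_alg =
    Output "bool list"
  | Query "bool list \<Rightarrow> real" real "real \<Rightarrow> sq_alg"

primrec all_queries :: "((bool list \<Rightarrow> real) \<Rightarrow> real \<Rightarrow> bool) \<Rightarrow> sq_alg \<Rightarrow> bool" where
  "all_queries P (Output z) \<longleftrightarrow> True"
| "all_queries P (Query q \<tau> next_step) \<longleftrightarrow> P q \<tau> \<and> (\<forall>v. all_queries P (next_step v))"

definition sq_algorithm :: "nat \<Rightarrow> sq_alg \<Rightarrow> bool" where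
  "sq_algorithm n A \<longleftrightarrow>
     all_queries (\<lambda>q \<tau>. (\<forall>y. length y = n \<longrightarrow> q y \<in> {-1..1}) \<and> \<tau> \<in> {0<..<1}) A"

definition local_query :: "nat \<Rightarrow> nat \<Rightarrow> (bool list \<Rightarrow> real) \<Rightarrow> bool" where
  "local_query n l q \<longleftrightarrow>
     (\<exists>i q'. i + l \<le> n \<and> (\<forall>z. length z = l \<longrightarrow> q' z \<in> {-1..1}) \<and>
        (\<forall>y. length y = n \<longrightarrow> q y = q' (take l (drop i y))))"

inductive sq_run :: "real \<Rightarrow> bool list \<Rightarrow> sq_alg \<Rightarrow> bool list \<Rightarrow> bool" for \<delta> x where
  "sq_run \<delta> x (Output z) z"
| "sq_response \<delta> x q \<tau> v \<Longrightarrow> sq_run \<delta> x (next_step v) z \<Longrightarrow> sq_run \<delta> x (Query q \<tau> next_step) z"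

definition solves_worst_case :: "real \<Rightarrow> nat \<Rightarrow> sq_alg \<Rightarrow> bool" where
  "solves_worst_case \<delta> n A \<longleftrightarrow> (\<forall>x z. length x = n \<longrightarrow> sq_run \<delta> x A z \<longrightarrow> z = x)"

end

theory Submission
  imports Defs "HOL-Complex_Analysis.Complex_Analysis" "HOL-Real_Asymp.Real_Asymp"
begin

text \<open>
  It suffices to separate two strings \<open>x \<noteq> x'\<close> by one local query whose expectations differ by
  \<open>exp (- O(m log\<^sup>2 n))\<close>, where \<open>m\<close> is about \<open>n\<close> to the power 1/5: asking all these queries and
  returning any consistent string then reconstructs the source.

  Let \<open>i\<close> be the first index where the strings differ. If \<open>i \<ge> 2m - 1\<close>, one of the two one-bit
  extensions \<open>w\<close> of the \<open>2m - 1\<close> bits before \<open>i\<close> has no period \<open>\<le> m\<close> (Robson), so its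
  occurrences in either string are more than \<open>m\<close> apart. The difference of the generating functions
  of the occurrences of \<open>w\<close> in \<open>x\<close> and \<open>x'\<close> is therefore, up to sign and a power of \<open>z\<close>,
  \<open>f z = 1 + \<alpha> z\<^sup>d + O(n \<bar>z\<bar>\<^sup>m)\<close>. Following Chase, this sparsity yields a point \<open>z\<close> of modulus
  \<open>1 - O(1/n)\<close> with \<open>\<bar>1 - z\<bar> = O(log n / m\<^sup>2)\<close> and \<open>\<bar>f z\<bar> \<ge> exp (- O(m log\<^sup>2 n))\<close>: compose \<open>f\<close> and
  \<open>1 + \<alpha> z\<^sup>d\<close> with a self-map \<open>h\<close> of the disc fixing 0 with \<open>\<bar>h z\<bar> \<le> exp (- \<bar>1 - z\<bar>)\<close>, and apply
  the maximum principle to the product of the quotient over the \<open>m\<^sup>2\<close> rotations. All rotations far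
  from 1 contribute almost nothing, those at distance \<open>O(log n / m)\<close> contribute a factor polynomial in \<open>n\<close>
  each, and one of them lands near 1.

  A trace shows the occurrences of \<open>w\<close> only as subsequences. Weighting a subsequence by \<open>v\<close> for every
  letter before it and by \<open>u\<close> for every letter skipped inside it, deletion replaces a weight \<open>u\<close> by
  \<open>\<delta> + (1 - \<delta>) u\<close>. Contiguous occurrences correspond to inner weight 0 in the source; the same
  rotation argument moves it to a point \<open>\<delta> + (1 - \<delta>) u\<close> with \<open>\<bar>u\<bar> \<le> 1/2\<close>, for which long windows can be
  truncated. If \<open>i < 2m - 1\<close>, single bits with weight \<open>\<bar>v\<bar> \<le> 1/2\<close> suffice.
\<close>

subsection \<open>Large values of sparse analytic functions near 1\<close>

lemma max_modulus_on_circle: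
  fixes f :: "complex \<Rightarrow> complex"
  assumes "f holomorphic_on ball 0 1" and "0 < r" "r < 1"
  shows "\<exists>\<phi>\<ge>0. norm (f 0) \<le> norm (f (of_real r * cis \<phi>))"
proof -
  have cont: "continuous_on (cball 0 r) f"
    using assms by (intro holomorphic_on_imp_continuous_on holomorphic_on_subset[OF assms(1)]) auto
  have "continuous_on (sphere 0 r) (\<lambda>z. norm (f z))"
    using cont by (intro continuous_on_norm) (auto intro: continuous_on_subset)
  moreover have "sphere (0::complex) r \<noteq> {}"
    using assms by simp
  ultimately obtain \<zeta> where \<zeta>: "\<zeta> \<in> sphere 0 r" "\<And>z. z \<in> sphere 0 r \<Longrightarrow> norm (f z) \<le> norm (f \<zeta>)"
    using continuous_attains_sup[OF compact_sphere] by metis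
  have "norm (f 0) \<le> norm (f \<zeta>)"
  proof (rule maximum_modulus_frontier[of f "cball 0 r"])
    show "f holomorphic_on interior (cball 0 r)"
      using assms by (auto intro!: holomorphic_on_subset[OF assms(1)])
  qed (use \<zeta> cont assms in auto)
  \<comment> \<open>\<open>Arg2pi\<close> takes values in [0, 2 pi), so the angle is nonnegative, as
    the rounding by \<open>nat\<close> in \<open>rotation_max_modulus\<close> requires.\<close>
  moreover have "\<zeta> = of_real r * cis (Arg2pi \<zeta>)"
    using \<zeta>(1) Arg2pi_eq[of \<zeta>] by (simp add: cis_conv_exp)
  ultimately show ?thesis
    using Arg2pi_ge_0 by metis
qed

text \<open>Advancing the base angle by one step 2 pi / \<open>J\<close> permutes the
  \<open>J\<close> factors cyclically: by periodicity the last new factor is the old factor at index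
  0.\<close>

lemma prod_rotation_shift:
  fixes g :: "real \<Rightarrow> 'a :: comm_monoid_mult"
  assumes per: "\<And>t. g (t + 2*pi) = g t" and "0 < J"
  shows "(\<Prod>j<J. g (t + 2*pi*real k/real J + 2*pi*real j/real J)) = (\<Prod>j<J. g (t + 2*pi*real j/real J))"
proof (induction k)
  case (Suc k)
  obtain J' where J: "J = Suc J'"
    using \<open>0 < J\<close> by (cases J) auto
  define h where "h j = g (t + 2*pi*real k/real J + 2*pi*real j/real J)" for j
  have "h (Suc J') = h 0"
    using per[of "t + 2*pi*real k/real J"] by (simp add: h_def J del: of_nat_Suc)
  have "(\<Prod>j<J. g (t + 2*pi*real (Suc k)/real J + 2*pi*real j/real J)) = (\<Prod>j<J. h (Suc j))"
    by (simp add: h_def add_divide_distrib distrib_left algebra_simps)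
  also have "\<dots> = (\<Prod>j<J'. h (Suc j)) * h 0"
    by (simp add: J \<open>h (Suc J') = h 0\<close>)
  also have "\<dots> = (\<Prod>j<J. h j)"
    unfolding J prod.lessThan_Suc_shift by (simp add: mult.commute)
  finally show ?case
    using Suc by (simp add: h_def)
qed auto

text \<open>The product \<open>F\<close> of the \<open>J\<close> rotated copies of \<open>f\<close>
  equals \<open>f 0 ^ J\<close> at 0, and the maximum principle applies to it. Since
  \<open>F\<close> is invariant under rotation by 2 pi / \<open>J\<close>, the maximising angle can
  be reduced to at most 2 pi / \<open>J\<close>; the factor at index 0 then sits close to the
  positive real axis.\<close>

lemma rotation_max_modulus:
  fixes f :: "complex \<Rightarrow> complex"
  assumes "f holomorphic_on ball 0 1" and "0 < r" "r < 1" and "0 < J"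
  shows "\<exists>\<theta>. 0 \<le> \<theta> \<and> \<theta> \<le> 2*pi/real J \<and>
           norm (f 0) ^ J \<le> (\<Prod>j<J. norm (f (of_real r * cis (\<theta> + 2*pi*real j/real J))))"
proof -
  define F where "F \<zeta> = (\<Prod>j<J. f (\<zeta> * cis (2*pi*real j/real J)))" for \<zeta>
  have "F holomorphic_on ball 0 1"
    unfolding F_def
  proof (intro holomorphic_on_prod)
    fix j
    have "f \<circ> (\<lambda>\<zeta>. \<zeta> * cis (2*pi*real j/real J)) holomorphic_on ball 0 1"
      by (rule holomorphic_on_compose_gen[OF _ assms(1)])
         (auto intro!: holomorphic_intros simp: norm_mult)
    then show "(\<lambda>\<zeta>. f (\<zeta> * cis (2*pi*real j/real J))) holomorphic_on ball 0 1"
      by (simp add: o_def)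
  qed
  then obtain \<phi> where \<phi>: "\<phi> \<ge> 0" "norm (F 0) \<le> norm (F (of_real r * cis \<phi>))"
    using max_modulus_on_circle assms by blast
  define g where "g t = norm (f (of_real r * cis t))" for t
  define k where "k = nat \<lfloor>\<phi> * real J / (2*pi)\<rfloor>"
  define \<theta> where "\<theta> = \<phi> - 2*pi*real k/real J"
  have "0 \<le> \<phi> * real J / (2*pi)"
    using \<phi> by simp
  then have k: "real k \<le> \<phi> * real J / (2*pi)" "\<phi> * real J / (2*pi) \<le> real k + 1"
    unfolding k_def by linarith+
  have "2*pi*real k/real J \<le> \<phi>" "\<phi> \<le> (2*pi*real k + 2*pi)/real J"
    using k assms(4) by (simp_all add: field_simps)
  then have "0 \<le> \<theta>" "\<theta> \<le> 2*pi/real J"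
    by (simp_all add: \<theta>_def add_divide_distrib)
  moreover have "norm (f 0) ^ J \<le> (\<Prod>j<J. g (\<theta> + 2*pi*real j/real J))"
  proof -
    have "norm (f 0) ^ J \<le> (\<Prod>j<J. g (\<phi> + 2*pi*real j/real J))"
      using \<phi>(2) by (simp add: F_def norm_power prod_norm[symmetric] g_def mult.assoc cis_mult)
    also have "\<dots> = (\<Prod>j<J. g (\<theta> + 2*pi*real k/real J + 2*pi*real j/real J))"
      by (simp add: \<theta>_def)
    also have "\<dots> = (\<Prod>j<J. g (\<theta> + 2*pi*real j/real J))"
      using \<open>0 < J\<close> by (intro prod_rotation_shift) (auto simp: g_def cis_mult[symmetric])
    finally show ?thesis .
  qed
  ultimately show ?thesis
    by (auto simp: g_def)
qed

text \<open>
  With \<open>1 - z = \<rho> exp (\<i> \<psi>)\<close> and \<open>\<rho> \<le> 2\<close>, the real part of the exponent is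
  \<open>\<rho> (cos \<psi> (1 + ln 2 - ln \<rho>) + \<psi> sin \<psi>) \<ge> \<rho>\<close>. Hence the map fixes 0, sends \<open>z\<close> to a point of
  modulus at most \<open>exp (- \<bar>1 - z\<bar>)\<close>, and moves points near 1 only by a logarithmic factor.
\<close>

definition cusp_exponent :: "complex \<Rightarrow> complex" where
  "cusp_exponent z = (1 - z) * (of_real (1 + ln 2) - Ln (1 - z))"

definition cusp_map :: "complex \<Rightarrow> complex" where
  "cusp_map z = z * exp (- cusp_exponent z)"

lemma one_minus_ball:
  fixes z :: complex
  assumes "z \<in> ball 0 1"
  shows "Re (1 - z) > 0" "1 - z \<notin> \<real>\<^sub>\<le>\<^sub>0" "norm (1 - z) < 2" "1 - z \<noteq> 0"
proof -
  have "Re z < 1"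
    using assms complex_Re_le_cmod[of z] by simp
  then show "Re (1 - z) > 0" by simp
  then show "1 - z \<notin> \<real>\<^sub>\<le>\<^sub>0" "1 - z \<noteq> 0"
    by (auto simp: complex_nonpos_Reals_iff)
  show "norm (1 - z) < 2"
    using norm_triangle_ineq4[of 1 z] assms by simp
qed

lemma cusp_map_holomorphic: "cusp_map holomorphic_on ball 0 1"
  unfolding cusp_map_def[abs_def] cusp_exponent_def
  using one_minus_ball(2) by (intro holomorphic_intros) auto

lemma cos_plus_mult_sin_ge_1:
  fixes t :: real
  assumes "\<bar>t\<bar> \<le> pi/2"
  shows "cos t + t * sin t \<ge> 1"
proof -
  have *: "cos t + t * sin t \<ge> 1" if "0 \<le> t" "t \<le> pi/2" for t :: real
  proof -
    have "cos 0 + 0 * sin 0 \<le> cos t + t * sin t"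
    proof (rule DERIV_nonneg_imp_nondecreasing[OF that(1)])
      fix s assume s: "0 \<le> s" "s \<le> t"
      have "((\<lambda>s. cos s + s * sin s) has_real_derivative s * cos s) (at s)"
        by (auto intro!: derivative_eq_intros)
      moreover have "s * cos s \<ge> 0"
        using s that by (intro mult_nonneg_nonneg cos_ge_zero) auto
      ultimately show "\<exists>y. ((\<lambda>s. cos s + s * sin s) has_real_derivative y) (at s) \<and> 0 \<le> y"
        by blast
    qed
    then show ?thesis by simp
  qed
  show ?thesis
    using *[of t] *[of "-t"] assms by (cases "t \<ge> 0") auto
qed

lemma Re_cusp_exponent_ge:
  assumes "z \<in> ball 0 1"
  shows "Re (cusp_exponent z) \<ge> norm (1 - z)"
proof -
  note w = one_minus_ball[OF assms]
  define \<rho> where "\<rho> = norm (1 - z)"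
  define \<psi> where "\<psi> = Im (Ln (1 - z))"
  have \<rho>: "0 < \<rho>" "\<rho> < 2"
    using w by (auto simp: \<rho>_def)
  have \<psi>: "\<bar>\<psi>\<bar> < pi/2"
    using Re_Ln_pos_lt w(1,4) by (simp add: \<psi>_def)
  have ln: "Re (Ln (1 - z)) = ln \<rho>"
    using w by (simp add: \<rho>_def)
  have "1 - z = exp (Ln (1 - z))"
    using w by simp
  then have w_eq: "Re (1 - z) = \<rho> * cos \<psi>" "Im (1 - z) = \<rho> * sin \<psi>"
    using \<rho> by (metis Re_exp Im_exp ln \<psi>_def exp_ln)+
  have "Re (cusp_exponent z) = \<rho> * (cos \<psi> * (1 + (ln 2 - ln \<rho>)) + \<psi> * sin \<psi>)"
    unfolding cusp_exponent_def times_complex.sel w_eq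
    by (simp add: ln \<psi>_def[symmetric] algebra_simps)
  \<comment> \<open>The summand ln 2 in \<open>cusp_exponent\<close> makes
    \<open>ln 2 - ln \<rho>\<close> nonnegative, as \<open>\<rho> < 2\<close> on the disc.\<close>
  moreover have "cos \<psi> * 1 \<le> cos \<psi> * (1 + (ln 2 - ln \<rho>))"
    using \<psi> \<rho> by (intro mult_left_mono cos_ge_zero) auto
  ultimately show ?thesis
    using cos_plus_mult_sin_ge_1[of \<psi>] \<psi> \<rho> mult_left_mono[of 1 "cos \<psi> * (1 + (ln 2 - ln \<rho>)) + \<psi> * sin \<psi>" \<rho>]
    by (simp add: \<rho>_def)
qed

lemma norm_cusp_map_le:
  assumes "z \<in> ball 0 1"
  shows "norm (cusp_map z) \<le> exp (- norm (1 - z))"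
proof -
  have "norm (cusp_map z) \<le> 1 * exp (- Re (cusp_exponent z))"
    unfolding cusp_map_def norm_mult using assms by (intro mult_mono) auto
  also have "\<dots> \<le> exp (- norm (1 - z))"
    using Re_cusp_exponent_ge[OF assms] by simp
  finally show ?thesis .
qed

text \<open>The derivative of exp has modulus at most 1 on the closed left half-plane, which is
  convex. On the imaginary axis this also bounds \<open>1 - cis t\<close> by the angle.\<close>

lemma norm_one_minus_exp_le:
  fixes z :: complex
  assumes "Re z \<ge> 0"
  shows "norm (1 - exp (- z)) \<le> norm z"
proof -
  have "norm (exp (-z) - exp 0) \<le> 1 * norm (-z - 0)"
  proof (rule field_differentiable_bound[of "{w. Re w \<le> 0}"])
    show "convex {w::complex. Re w \<le> 0}"
      by (rule convex_halfspace_Re_le)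
    show "(exp has_field_derivative exp w) (at w within {w. Re w \<le> 0})" for w :: complex
      by (rule DERIV_subset[OF DERIV_exp]) auto
  qed (use assms in auto)
  then show ?thesis
    by (simp add: norm_minus_commute)
qed

text \<open>Besides \<open>1 - z\<close> itself, the displacement is at most the modulus of
  \<open>cusp_exponent z\<close>. There 4 bounds 1 + ln 2 together with the argument of
  \<open>1 - z\<close>, and the lower bound \<open>1 / b\<close> keeps the logarithm below
  \<open>ln b\<close>.\<close>

lemma norm_one_minus_cusp_map_le:
  assumes z: "z \<in> ball 0 1" and "norm (1 - z) \<le> a" and "1 / b \<le> norm (1 - z)" and "2 \<le> b"
  shows "norm (1 - cusp_map z) \<le> a * (5 + ln b)"
proof -
  note w = one_minus_ball[OF z]
  have Re: "Re (cusp_exponent z) \<ge> 0"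
    using Re_cusp_exponent_ge[OF z] norm_ge_zero order_trans by blast
  have "\<bar>ln (norm (1 - z))\<bar> \<le> ln b"
  proof -
    have "ln (norm (1 - z)) \<le> ln b"
      using w assms by (subst ln_le_cancel_iff) auto
    moreover have "ln (1/b) \<le> ln (norm (1 - z))"
      using w assms by (subst ln_le_cancel_iff) auto
    ultimately show ?thesis using assms by (simp add: ln_div)
  qed
  then have "norm (Ln (1 - z)) \<le> ln b + 2"
    using cmod_le[of "Ln (1 - z)"] Re_Ln_pos_lt[OF w(4)] w(1,4) pi_less_4 by simp
  then have "norm (of_real (1 + ln 2) - Ln (1 - z)) \<le> (1 + ln 2) + (ln b + 2)"
    using norm_triangle_ineq4[of "of_real (1 + ln 2)" "Ln (1 - z)"] by (simp add: norm_of_real del: of_real_add)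
  also have "\<dots> \<le> 4 + ln b"
    using ln_2_less_1 by simp
  finally have "norm (cusp_exponent z) \<le> a * (4 + ln b)"
    unfolding cusp_exponent_def norm_mult using assms
    by (intro mult_mono) (auto intro: order_trans[OF norm_ge_zero])
  moreover have "norm (1 - cusp_map z) \<le> norm (1 - z) + norm (cusp_exponent z)"
  proof -
    have "1 - cusp_map z = (1 - z) + z * (1 - exp (- cusp_exponent z))"
      by (simp add: cusp_map_def algebra_simps)
    then have "norm (1 - cusp_map z) \<le> norm (1 - z) + norm z * norm (1 - exp (- cusp_exponent z))"
      by (metis norm_mult norm_triangle_ineq)
    also have "norm z * norm (1 - exp (- cusp_exponent z)) \<le> 1 * norm (cusp_exponent z)"
      using z by (intro mult_mono norm_one_minus_exp_le Re) auto
    finally show ?thesis by simp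
  qed
  ultimately show ?thesis
    using assms by (simp add: algebra_simps)
qed

section \<open>Counting the rotations near 1\<close>

lemma sin_ge_half:
  fixes x :: real
  assumes "0 \<le> x" "x \<le> pi/2"
  shows "x/2 \<le> sin x"
proof -
  define y where "y = x/2"
  have y: "0 \<le> y" "y \<le> pi/4"
    using assms by (auto simp: y_def)
  have "sin 0 - 0 * cos 0 \<le> sin y - y * cos y"
  proof (rule DERIV_nonneg_imp_nondecreasing[OF y(1)])
    fix s assume s: "0 \<le> s" "s \<le> y"
    have "((\<lambda>s. sin s - s * cos s) has_real_derivative s * sin s) (at s)"
      by (auto intro!: derivative_eq_intros)
    moreover have "s * sin s \<ge> 0"
      using s y by (intro mult_nonneg_nonneg sin_ge_zero) auto
    ultimately show "\<exists>t. ((\<lambda>s. sin s - s * cos s) has_real_derivative t) (at s) \<and> 0 \<le> t"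
      by blast
  qed
  then have "y * cos y \<le> sin y" by simp
  moreover have "cos y \<ge> 0"
    using y by (intro cos_ge_zero) auto
  ultimately have "2 * (y * cos y) * cos y \<le> 2 * sin y * cos y"
    by (intro mult_right_mono) auto
  \<comment> \<open>With \<open>x = 2 * y\<close> the double angle formula for sin gives this;
    moreover \<open>(cos y)\<^sup>2\<close> is (1 + cos x) / 2, hence at least 1/2.\<close>
  then have "x * (cos y)\<^sup>2 \<le> sin x"
    using sin_double[of y] by (simp add: y_def power2_eq_square)
  moreover have "(cos y)\<^sup>2 \<ge> 1/2"
    using cos_double_cos[of y] cos_ge_zero[of x] assms by (simp add: y_def)
  then have "x * (1/2) \<le> x * (cos y)\<^sup>2"
    using assms by (intro mult_left_mono) auto
  ultimately show ?thesis by simp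
qed

text \<open>The squared distance is
  \<open>(1 - r)\<^sup>2 + 4 * r * (sin (\<phi>/2))\<^sup>2\<close>.\<close>

lemma sin_half_le_norm_one_minus:
  assumes "1/2 \<le> r"
  shows "\<bar>sin (\<phi>/2)\<bar> \<le> norm (1 - of_real r * cis \<phi>)"
proof (rule power2_le_imp_le)
  have "(norm (1 - of_real r * cis \<phi>))\<^sup>2 = (1 - r * cos \<phi>)\<^sup>2 + (r * sin \<phi>)\<^sup>2"
    by (simp add: cmod_power2)
  also have "\<dots> = 1 - 2 * r * cos \<phi> + r\<^sup>2 * ((cos \<phi>)\<^sup>2 + (sin \<phi>)\<^sup>2)"
    by algebra
  also have "\<dots> = (1 - r)\<^sup>2 + 2 * r * (1 - cos (2 * (\<phi>/2)))"
    by (simp add: power2_eq_square algebra_simps)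
  also have "\<dots> = (1 - r)\<^sup>2 + 4 * r * (sin (\<phi>/2))\<^sup>2"
    unfolding cos_double_sin by simp
  also have "\<dots> \<ge> 0 + 1 * (sin (\<phi>/2))\<^sup>2"
    using assms by (intro add_mono mult_right_mono) auto
  finally show "\<bar>sin (\<phi>/2)\<bar>\<^sup>2 \<le> (norm (1 - of_real r * cis \<phi>))\<^sup>2"
    by simp
qed auto

text \<open>A rotation within \<open>T\<close> of 1 has a half-angle x in [0, pi] with sin x at most
  \<open>T\<close>, so x or pi - x is at most \<open>2 * T\<close>. Half-angles advance by pi /
  \<open>M\<close>, so only indices at the two ends of the range qualify.\<close>

lemma card_rotations_near_one:
  assumes "1/2 \<le> r" and "0 < M" and "0 \<le> T" and \<theta>: "0 \<le> \<theta>" "\<theta> \<le> 2*pi/real M"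
  shows "real (card {j. j < M \<and> norm (1 - of_real r * cis (\<theta> + 2*pi*real j/real M)) \<le> T}) \<le> 2 * (real M * T) + 2"
proof -
  define k where "k = nat \<lfloor>real M * T\<rfloor>"
  have "0 \<le> real M * T"
    using assms by simp
  then have k: "real k \<le> real M * T"
    unfolding k_def by linarith
  \<comment> \<open>Since pi is at least 2, the bound \<open>2 * T\<close> on the half-angle turns
    into the bound \<open>real M * T\<close> on the index.\<close>
  have near: "j \<le> k" if "pi * real j / real M \<le> 2 * T" for j
  proof -
    have "pi * real j \<le> 2 * (real M * T)"
      using that \<open>0 < M\<close> by (simp add: field_simps)
    moreover have "2 * real j \<le> pi * real j"
      using pi_ge_two by (intro mult_right_mono) auto
    ultimately show ?thesis
      unfolding k_def by (simp add: le_nat_floor)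
  qed
  have "{j. j < M \<and> norm (1 - of_real r * cis (\<theta> + 2*pi*real j/real M)) \<le> T} \<subseteq> {..k} \<union> (\<lambda>i. M - 1 - i) ` {..k}"
  proof (safe)
    fix j assume j: "j < M" "norm (1 - of_real r * cis (\<theta> + 2*pi*real j/real M)) \<le> T"
      "j \<notin> (\<lambda>i. M - 1 - i) ` {..k}"
    define x where "x = (\<theta> + 2*pi*real j/real M) / 2"
    have x_lo: "pi * real j / real M \<le> x"
      using \<theta> by (simp add: x_def mult_ac)
    have "x \<le> pi / real M + pi * real j / real M"
      using \<theta> by (simp add: x_def mult_ac)
    also have "\<dots> = pi - pi * real (M - 1 - j) / real M"
      using j(1) \<open>0 < M\<close> by (simp add: field_simps of_nat_diff)
    finally have x_hi: "pi * real (M - 1 - j) / real M \<le> pi - x"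
      by simp
    have "0 \<le> x"
      using \<theta> by (simp add: x_def)
    have "0 \<le> pi * real (M - 1 - j) / real M"
      by simp
    then have "x \<le> pi"
      using x_hi by linarith
    have "sin x \<le> T"
      using sin_half_le_norm_one_minus[OF assms(1), of "\<theta> + 2*pi*real j/real M"] j(2)
      unfolding x_def by linarith
    show "j \<le> k"
    proof (cases "x \<le> pi/2")
      case True
      then have "x/2 \<le> T"
        using sin_ge_half[of x] \<open>0 \<le> x\<close> \<open>sin x \<le> T\<close> by linarith
      then show ?thesis
        using x_lo by (intro near) linarith
    next
      case False
      then have "(pi - x)/2 \<le> sin (pi - x)"
        using \<open>x \<le> pi\<close> by (intro sin_ge_half) auto
      then have "pi - x \<le> 2 * T"
        using \<open>sin x \<le> T\<close> by simp
      then have "M - 1 - j \<le> k"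
        using x_hi by (intro near) linarith
      then have "j \<in> (\<lambda>i. M - 1 - i) ` {..k}"
        using j(1) by (intro image_eqI[of _ _ "M - 1 - j"]) auto
      then show ?thesis
        using j(3) by simp
    qed
  qed
  then have "card {j. j < M \<and> norm (1 - of_real r * cis (\<theta> + 2*pi*real j/real M)) \<le> T} \<le> card ({..k} \<union> (\<lambda>i. M - 1 - i) ` {..k})"
    by (intro card_mono) auto
  also have "\<dots> \<le> card {..k} + card ((\<lambda>i. M - 1 - i) ` {..k})"
    by (rule card_Un_le)
  also have "\<dots> \<le> Suc k + Suc k"
    using card_image_le[of "{..k}" "\<lambda>i. M - 1 - i"] by (intro add_mono) auto
  finally show ?thesis
    using k by simp
qed

lemma exp_minus_le_one_minus_half:
  fixes s :: real
  assumes "0 \<le> s" "s \<le> 1"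
  shows "exp (- s) \<le> 1 - s/2"
proof -
  have "s * s \<le> 1 * s"
    using assms by (intro mult_right_mono) auto
  then have "1 \<le> (1 - s/2) * (1 + s)"
    by (simp add: algebra_simps)
  also have "\<dots> \<le> (1 - s/2) * exp s"
    using assms by (intro mult_left_mono exp_ge_add_one_self) auto
  finally show ?thesis
    by (simp add: exp_minus field_simps)
qed

text \<open>The exponent collects 1 for the factors 1 + 1/\<open>M\<close> of all rotations, one
  \<open>ln (4 * real m ^ 2 * N)\<close> for each of the at most
  \<open>2 * real m * ln (4 * real m ^ 4 * N) + 2\<close> rotations near 1, and one more for passing
  from the quotient \<open>R\<close> back to \<open>f\<close> at the chosen point.\<close>

lemma large_value_near_one:
  fixes f :: "complex \<Rightarrow> complex"
  assumes holo: "f holomorphic_on ball 0 1"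
    and bound: "\<And>z. z \<in> ball 0 1 \<Longrightarrow> norm (f z) \<le> N"
    and approx: "\<And>z. z \<in> ball 0 1 \<Longrightarrow> norm (f z - (1 + \<alpha> * z ^ d)) \<le> N * norm z ^ m"
    and \<alpha>: "norm \<alpha> \<le> 1" and "0 < d" and "0 < m" and "1 \<le> N"
  shows "\<exists>z\<in>ball 0 1. norm (1 - z) \<le> 7 / real m ^ 2 * (5 + ln (2 * real m ^ 2)) \<and>
           exp (- (1 + (2 * real m * ln (4 * real m ^ 4 * N) + 3) * ln (4 * real m ^ 2 * N))) \<le> norm (f z)"
proof -
  \<comment> \<open>The radius \<open>r\<close> keeps the sample points at distance at least 1 / (2
    \<open>M\<close>) from 1, which bounds the denominator of \<open>R\<close> below by 1 / (4
    \<open>M\<close>). \<open>T\<close> solves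
    \<open>N * exp (- T) ^ m = 1 / (4 * real M ^ 2)\<close>, and \<open>Q\<close> bounds every
    factor.\<close>
  define M where "M = m\<^sup>2"
  define r where "r = 1 - 1 / (2 * real M)"
  define T where "T = ln (4 * real M ^ 2 * N) / real m"
  define Q where "Q = 4 * real M * N"
  define R where "R \<zeta> = f (cusp_map \<zeta>) / (1 + \<alpha> * cusp_map \<zeta> ^ d)" for \<zeta>
  have M: "M \<ge> 1"
    using \<open>0 < m\<close> by (simp add: M_def Suc_leI)
  then have r: "0 < r" "r < 1" "1/2 \<le> r"
    by (auto simp: r_def field_simps)
  have MN: "1 * 1 \<le> real M * N"
    using M \<open>1 \<le> N\<close> by (intro mult_mono) auto
  then have Q: "1 \<le> Q" by (simp add: Q_def)
  have MMN: "1 * 1 \<le> real M ^ 2 * N"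
    using M \<open>1 \<le> N\<close> by (intro mult_mono) auto
  then have "0 \<le> ln (4 * real M ^ 2 * N)"
    by (intro ln_ge_zero) auto
  then have T: "0 \<le> T"
    by (simp add: T_def)
  \<comment> \<open>Because \<open>0 < d\<close>, the power \<open>z ^ d\<close> is no larger than
    \<open>z\<close>, whose modulus is at most \<open>exp (- s)\<close> and hence at most
    \<open>1 - s/2\<close>.\<close>
  have denom: "s/2 \<le> norm (1 + \<alpha> * z ^ d)" if "norm z \<le> exp (- s)" "0 \<le> s" "s \<le> 1" for s z
  proof -
    have "norm z \<le> 1"
      using that by (meson exp_le_one_iff neg_le_0_iff_le order_trans)
    then have "norm z ^ d \<le> norm z"
      using \<open>0 < d\<close> power_decreasing[of 1 d "norm z"] by simp
    moreover have "norm (\<alpha> * z ^ d) \<le> 1 * norm z ^ d"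
      unfolding norm_mult norm_power using \<alpha> by (intro mult_right_mono) auto
    ultimately have "norm (\<alpha> * z ^ d) \<le> 1 - s/2"
      using exp_minus_le_one_minus_half[OF that(2,3)] that(1) by linarith
    then show ?thesis
      using norm_diff_ineq[of 1 "\<alpha> * z ^ d"] by simp
  qed
  have cusp_ball: "cusp_map z \<in> ball 0 1" if "z \<in> ball 0 1" for z
  proof -
    have "exp (- norm (1 - z)) < 1"
      using one_minus_ball(4)[OF that] by simp
    then show ?thesis
      using norm_cusp_map_le[OF that] unfolding mem_ball_0 by linarith
  qed
  have R_holo: "R holomorphic_on ball 0 1"
    unfolding R_def
  proof (intro holomorphic_intros cusp_map_holomorphic)
    show "(\<lambda>x. f (cusp_map x)) holomorphic_on ball 0 1"
      using holomorphic_on_compose_gen[OF cusp_map_holomorphic holo] cusp_ball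
      by (simp add: o_def image_subset_iff)
    show "1 + \<alpha> * cusp_map z ^ d \<noteq> 0" if "z \<in> ball 0 1" for z
    proof -
      define s where "s = min 1 (norm (1 - z))"
      have "norm (cusp_map z) \<le> exp (- s)"
        using norm_cusp_map_le[OF that] by (rule order_trans) (simp add: s_def)
      then have "s/2 \<le> norm (1 + \<alpha> * cusp_map z ^ d)"
        by (intro denom) (auto simp: s_def)
      moreover have "0 < s"
        using one_minus_ball(4)[OF that] by (auto simp: s_def)
      ultimately show ?thesis by auto
    qed
  qed
  have "norm (R 0) = 1"
    using approx[of 0] \<open>0 < m\<close> \<open>0 < d\<close> by (simp add: R_def cusp_map_def zero_power)
  then obtain \<theta> where \<theta>: "0 \<le> \<theta>" "\<theta> \<le> 2*pi/real M"
    and prod: "1 \<le> (\<Prod>j<M. norm (R (of_real r * cis (\<theta> + 2*pi*real j/real M))))"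
    using rotation_max_modulus[OF R_holo r(1,2), of M] M by auto
  define z where "z j = of_real r * cis (\<theta> + 2*pi*real j/real M)" for j
  have z_ball: "z j \<in> ball 0 1" for j
    using r by (simp add: z_def norm_mult)
  have z_dist: "1 / (2 * real M) \<le> norm (1 - z j)" for j
  proof -
    have "norm (z j) = r"
      using r by (simp add: z_def norm_mult)
    then show ?thesis
      using norm_triangle_ineq2[of 1 "z j"] by (simp add: r_def)
  qed
  have denom_z: "1 / (4 * real M) \<le> norm (1 + \<alpha> * cusp_map (z j) ^ d)" for j
  proof -
    have "norm (cusp_map (z j)) \<le> exp (- (1 / (2 * real M)))"
      using norm_cusp_map_le[OF z_ball] by (rule order_trans) (use z_dist[of j] in simp)
    from denom[OF this] show ?thesis
      using M by simp
  qed
  have R_le: "norm (R (z j)) \<le> norm (f (cusp_map (z j))) * (4 * real M)" for j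
  proof -
    have "norm (R (z j)) \<le> norm (f (cusp_map (z j))) / (1 / (4 * real M))"
      unfolding R_def norm_divide using denom_z[of j] M by (intro divide_left_mono mult_pos_pos) (auto intro: less_le_trans[of _ "1 / (4 * real M)"])
    then show ?thesis by simp
  qed
  have R_Q: "norm (R (z j)) \<le> Q" for j
  proof -
    have "norm (f (cusp_map (z j))) * (4 * real M) \<le> N * (4 * real M)"
      using bound[OF cusp_ball[OF z_ball]] by (intro mult_right_mono) auto
    then show ?thesis
      using R_le[of j] by (simp add: Q_def mult_ac)
  qed
  define B where "B = {j. j < M \<and> norm (1 - z j) \<le> T}"
  have card_B: "real (card B) \<le> 2 * (real M * T) + 2"
    unfolding B_def z_def by (rule card_rotations_near_one[OF r(3) _ T \<theta>]) (use M in auto)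
  \<comment> \<open>Beyond distance \<open>T\<close> the error term is at most 1/\<open>M\<close>
    times the denominator, so all these factors together contribute at most (1 +
    1/\<open>M\<close>)^\<open>M\<close>, which is below e.\<close>
  have R_good: "norm (R (z j)) \<le> 1 + 1 / real M" if "j < M" "j \<notin> B" for j
  proof -
    let ?w = "cusp_map (z j)"
    define D where "D = 1 + \<alpha> * ?w ^ d"
    have "norm ?w \<le> exp (- T)"
      using norm_cusp_map_le[OF z_ball] by (rule order_trans) (use that in \<open>simp add: B_def\<close>)
    then have "norm ?w ^ m \<le> exp (- T) ^ m"
      by (intro power_mono) auto
    also have "\<dots> = exp (- ln (4 * real M ^ 2 * N))"
      using \<open>0 < m\<close> by (simp add: exp_of_nat_mult[symmetric] T_def)
    also have "\<dots> = 1 / (4 * real M ^ 2 * N)"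
      using M \<open>1 \<le> N\<close> by (simp add: exp_minus inverse_eq_divide)
    finally have "N * norm ?w ^ m \<le> N * (1 / (4 * real M ^ 2 * N))"
      using \<open>1 \<le> N\<close> by (intro mult_left_mono) auto
    also have "\<dots> = (1 / real M) * (1 / (4 * real M))"
      using \<open>1 \<le> N\<close> by (simp add: power2_eq_square)
    also have "\<dots> \<le> (1 / real M) * norm D"
      using denom_z[of j] by (intro mult_left_mono) (auto simp: D_def)
    finally have "norm (f ?w - D) \<le> (1 / real M) * norm D"
      using approx[OF cusp_ball[OF z_ball], of j] unfolding D_def by linarith
    moreover have "norm (f ?w) \<le> norm D + norm (f ?w - D)"
      using norm_triangle_ineq[of D "f ?w - D"] by simp
    ultimately have "norm (f ?w) \<le> (1 + 1 / real M) * norm D"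
      by (simp add: algebra_simps)
    moreover have "0 < norm D"
      using denom_z[of j] less_le_trans[of 0 "1 / (4 * real M)" "norm D"] M by (simp add: D_def)
    ultimately show ?thesis
      by (simp add: R_def norm_divide pos_divide_le_eq D_def)
  qed
  \<comment> \<open>Every majorant \<open>c j\<close> is at least 1, so index 0 can be put back into
    the product.\<close>
  define c where "c j = (1 + 1 / real M) * (if j \<in> B then Q else 1)" for j
  have c1: "1 \<le> c j" for j
    unfolding c_def using mult_mono[of 1 "1 + 1 / real M" 1 "if j \<in> B then Q else 1"] Q by auto
  have R_c: "norm (R (z j)) \<le> c j" if "j < M" for j
  proof (cases "j \<in> B")
    case True
    have "1 * Q \<le> (1 + 1 / real M) * Q"
      using Q by (intro mult_right_mono) auto
    with True show ?thesis
      using R_Q[of j] by (simp add: c_def)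
  qed (use R_good that in \<open>simp add: c_def\<close>)
  have "1 \<le> (\<Prod>j<M. norm (R (z j)))"
    using prod by (simp add: z_def)
  also have "\<dots> = norm (R (z 0)) * (\<Prod>j\<in>{..<M}-{0}. norm (R (z j)))"
    using M by (intro prod.remove) auto
  also have "\<dots> \<le> norm (R (z 0)) * (\<Prod>j\<in>{..<M}. c j)"
  proof (rule mult_left_mono)
    have "(\<Prod>j\<in>{..<M}-{0}. norm (R (z j))) \<le> (\<Prod>j\<in>{..<M}-{0}. c j)"
      using R_c by (intro prod_mono) auto
    also have "\<dots> \<le> (\<Prod>j\<in>{..<M}. c j)"
      using c1 by (intro prod_mono2) (auto intro: order_trans[of 0 1])
    finally show "(\<Prod>j\<in>{..<M}-{0}. norm (R (z j))) \<le> (\<Prod>j\<in>{..<M}. c j)" .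
  qed auto
  also have "(\<Prod>j<M. c j) = (1 + 1 / real M) ^ M * Q ^ card B"
  proof -
    have "(\<Prod>j<M. if j \<in> B then Q else 1) = Q ^ card B"
      by (subst prod.If_cases) (auto simp: B_def Int_def)
    then show ?thesis
      by (simp add: c_def prod.distrib)
  qed
  also have "norm (R (z 0)) * \<dots> \<le> (norm (f (cusp_map (z 0))) * Q) * (exp 1 * exp ((2 * (real M * T) + 2) * ln Q))"
  proof (intro mult_mono)
    have "norm (f (cusp_map (z 0))) * (4 * real M * 1) \<le> norm (f (cusp_map (z 0))) * Q"
      unfolding Q_def using \<open>1 \<le> N\<close> by (intro mult_left_mono) auto
    then show "norm (R (z 0)) \<le> norm (f (cusp_map (z 0))) * Q"
      using R_le[of 0] by simp
    have "(1 + 1 / real M) ^ M \<le> exp (1 / real M) ^ M"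
      by (intro power_mono exp_ge_add_one_self) auto
    then show "(1 + 1 / real M) ^ M \<le> exp 1"
      using M by (simp add: exp_of_nat_mult[symmetric])
    have "Q ^ card B = exp (real (card B) * ln Q)"
      using Q by (simp add: exp_of_nat_mult)
    then show "Q ^ card B \<le> exp ((2 * (real M * T) + 2) * ln Q)"
      using card_B Q by (simp add: mult_right_mono)
  qed (use Q in auto)
  also have "\<dots> = norm (f (cusp_map (z 0))) * exp (1 + (2 * (real M * T) + 3) * ln Q)"
  proof -
    have "1 + (2 * (real M * T) + 3) * ln Q = 1 + (2 * (real M * T) + 2) * ln Q + ln Q"
      by (simp add: algebra_simps)
    then have "exp (1 + (2 * (real M * T) + 3) * ln Q) = exp 1 * exp ((2 * (real M * T) + 2) * ln Q) * Q"
      using Q by (simp only: exp_add) simp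
    then show ?thesis by simp
  qed
  finally have "exp (- (1 + (2 * (real M * T) + 3) * ln Q)) \<le> norm (f (cusp_map (z 0)))"
    unfolding exp_minus inverse_eq_divide by (subst pos_divide_le_eq) auto
  moreover have "2 * (real M * T) = 2 * real m * ln (4 * real m ^ 4 * N)"
  proof -
    have "real M ^ 2 = real m ^ 4"
      by (simp add: M_def flip: power_mult)
    then show ?thesis
      unfolding T_def using \<open>0 < m\<close> by (simp add: M_def power2_eq_square)
  qed
  ultimately have big: "exp (- (1 + (2 * real m * ln (4 * real m ^ 4 * N) + 3) * ln (4 * real m ^ 2 * N))) \<le> norm (f (cusp_map (z 0)))"
    unfolding Q_def M_def by (simp only: of_nat_power)
  \<comment> \<open>The point has angle at most 2 pi / \<open>M\<close> and radius 1 - 1 / (2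
    \<open>M\<close>), and 2 pi + 1/2 is at most 7.\<close>
  have "norm (1 - z 0) \<le> 7 / real M"
  proof -
    have "norm (1 - z 0) \<le> norm (1 - cis \<theta>) + norm (cis \<theta> - z 0)"
      using norm_triangle_ineq[of "1 - cis \<theta>" "cis \<theta> - z 0"] by simp
    also have "norm (cis \<theta> - z 0) = norm (of_real (1 - r) * cis \<theta>)"
      by (simp add: z_def algebra_simps)
    also have "\<dots> = 1 / (2 * real M)"
      using r unfolding norm_mult norm_of_real by (simp add: r_def)
    also have "norm (1 - cis \<theta>) \<le> norm (\<i> * of_real \<theta>)"
      using norm_one_minus_exp_le[of "- (\<i> * of_real \<theta>)"] by (simp add: cis_conv_exp)
    also have "\<dots> \<le> 2*pi/real M"
      using \<theta> by (simp add: norm_mult)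
    also have "2*pi/real M + 1 / (2 * real M) = (2*pi + 1/2) / real M"
      by (simp add: add_divide_distrib)
    also have "\<dots> \<le> 7 / real M"
      using pi_less_4 pi_approx by (intro divide_right_mono) auto
    finally show ?thesis by simp
  qed
  from norm_one_minus_cusp_map_le[OF z_ball this z_dist] M
  have "norm (1 - cusp_map (z 0)) \<le> 7 / real M * (5 + ln (2 * real M))"
    by simp
  then have "norm (1 - cusp_map (z 0)) \<le> 7 / real m ^ 2 * (5 + ln (2 * real m ^ 2))"
    by (simp add: M_def)
  then show ?thesis
    using big cusp_ball[OF z_ball] by blast
qed

text \<open>A large value may be found deep inside the disc, where a factor \<open>z ^ k0\<close>
  would destroy it; this moves it out to modulus at least \<open>r\<close>. The disc automorphism
  \<open>\<phi>\<close> sends 0 to \<open>a\<close>. Four rotations leave a sample point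
  \<open>\<zeta>\<close> in the first quadrant, so the denominator \<open>1 + s * \<zeta>\<close>
  has modulus at least 1; hence \<open>\<phi> \<zeta>\<close> has modulus at least \<open>r\<close>
  and lies within \<open>1 - s\<^sup>2\<close> of \<open>a\<close>, which is at most twice the
  distance from \<open>a\<close> to 1.\<close>

lemma large_value_near_circle:
  fixes f :: "complex \<Rightarrow> complex"
  assumes holo: "f holomorphic_on ball 0 1"
    and bound: "\<And>z. z \<in> ball 0 1 \<Longrightarrow> norm (f z) \<le> N"
    and a: "a \<in> ball 0 1" and r: "0 < r" "r < 1"
  shows "\<exists>z\<in>ball 0 1. r \<le> norm z \<and> norm (1 - z) \<le> 3 * norm (1 - a) \<and> norm (f a) ^ 4 \<le> norm (f z) * N ^ 3"
proof -
  define s where "s = norm a"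
  define u where "u = cis (Arg a)"
  have a_eq: "a = of_real s * u"
    using rcis_cmod_Arg[of a] by (simp add: s_def u_def rcis_def)
  have u: "norm u = 1" "u * cnj u = 1"
    by (auto simp: u_def cis_cnj cis_mult)
  have s: "0 \<le> s" "s < 1"
    using a by (auto simp: s_def)
  define \<phi> where "\<phi> \<zeta> = u * ((\<zeta> + of_real s) / (1 + of_real s * \<zeta>))" for \<zeta>
  have nz: "1 + of_real s * \<zeta> \<noteq> 0" if "\<zeta> \<in> ball 0 1" for \<zeta> :: complex
  proof
    assume "1 + of_real s * \<zeta> = 0"
    then have "norm (of_real s * \<zeta>) = 1"
      by (metis add_eq_0_iff norm_minus_cancel norm_one)
    moreover have "s * norm \<zeta> \<le> 1 * norm \<zeta>"
      using s by (intro mult_right_mono) auto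
    ultimately show False
      using that s by (simp add: norm_mult)
  qed
  have norm_\<phi>: "1 - (norm (\<phi> \<zeta>))\<^sup>2 = (1 - s\<^sup>2) * (1 - (norm \<zeta>)\<^sup>2) / (norm (1 + of_real s * \<zeta>))\<^sup>2" if "\<zeta> \<in> ball 0 1" for \<zeta>
  proof -
    have "(norm (1 + of_real s * \<zeta>))\<^sup>2 - (norm (\<zeta> + of_real s))\<^sup>2 = (1 - s\<^sup>2) * (1 - (norm \<zeta>)\<^sup>2)"
      unfolding cmod_power2 by (simp add: power2_eq_square algebra_simps)
    moreover have "norm (\<phi> \<zeta>) = norm (\<zeta> + of_real s) / norm (1 + of_real s * \<zeta>)"
      by (simp add: \<phi>_def norm_mult norm_divide u)
    then have "1 - (norm (\<phi> \<zeta>))\<^sup>2 =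
        ((norm (1 + of_real s * \<zeta>))\<^sup>2 - (norm (\<zeta> + of_real s))\<^sup>2) / (norm (1 + of_real s * \<zeta>))\<^sup>2"
      using nz[OF that] by (simp add: power_divide diff_divide_distrib)
    ultimately show ?thesis
      by simp
  qed
  have \<phi>_ball: "\<phi> \<zeta> \<in> ball 0 1" if "\<zeta> \<in> ball 0 1" for \<zeta>
  proof -
    have "s\<^sup>2 < 1" "(norm \<zeta>)\<^sup>2 < 1"
      using s that by (auto simp: power_less_one_iff abs_square_less_1)
    then have "0 < 1 - (norm (\<phi> \<zeta>))\<^sup>2"
      unfolding norm_\<phi>[OF that] using nz[OF that] by (intro divide_pos_pos mult_pos_pos) auto
    then show ?thesis
      by (simp add: power_less_one_iff abs_square_less_1)
  qed
  have \<phi>_holo: "\<phi> holomorphic_on ball 0 1"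
    unfolding \<phi>_def using nz by (intro holomorphic_intros) auto
  have "f \<circ> \<phi> holomorphic_on ball 0 1"
    by (rule holomorphic_on_compose_gen[OF \<phi>_holo holo]) (use \<phi>_ball in auto)
  from rotation_max_modulus[OF this r, of 4] obtain \<theta> where \<theta>: "0 \<le> \<theta>" "\<theta> \<le> pi/2"
    and prod: "norm (f a) ^ 4 \<le> (\<Prod>j<4. norm (f (\<phi> (of_real r * cis (\<theta> + 2*pi*real j/4)))))"
    by (auto simp: \<phi>_def a_eq mult.commute)
  define \<zeta> where "\<zeta> = of_real r * cis \<theta>"
  have \<zeta>: "\<zeta> \<in> ball 0 1" "norm \<zeta> = r" "Re \<zeta> \<ge> 0"
    using r \<theta> cos_ge_zero[of \<theta>] by (auto simp: \<zeta>_def norm_mult)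
  have denom: "1 \<le> norm (1 + of_real s * \<zeta>)"
    using complex_Re_le_cmod[of "1 + of_real s * \<zeta>"] mult_nonneg_nonneg[OF s(1) \<zeta>(3)] by simp
  have rot_ball: "of_real r * cis t \<in> ball 0 1" for t
    using r by (simp add: norm_mult)
  have "norm (f a) ^ 4 \<le> norm (f (\<phi> \<zeta>)) * (\<Prod>j<3. norm (f (\<phi> (of_real r * cis (\<theta> + 2*pi*real (Suc j)/4)))))"
  proof -
    have "(4::nat) = Suc 3" by simp
    then show ?thesis
      using prod by (simp only: prod.lessThan_Suc_shift) (simp add: \<zeta>_def)
  qed
  also have "\<dots> \<le> norm (f (\<phi> \<zeta>)) * (\<Prod>j<3::nat. N)"
    using bound[OF \<phi>_ball[OF rot_ball]] by (intro mult_left_mono prod_mono) auto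
  finally have big: "norm (f a) ^ 4 \<le> norm (f (\<phi> \<zeta>)) * N ^ 3"
    by simp
  have "1 - (norm (\<phi> \<zeta>))\<^sup>2 \<le> (1 - s\<^sup>2) * (1 - r\<^sup>2) / 1"
    unfolding norm_\<phi>[OF \<zeta>(1)] \<zeta>(2)
  proof (rule divide_left_mono)
    show "1 \<le> (norm (1 + of_real s * \<zeta>))\<^sup>2"
      using denom by simp
    then show "0 < (norm (1 + of_real s * \<zeta>))\<^sup>2 * 1"
      by linarith
  qed (use s r in \<open>simp add: power_le_one\<close>)
  also have "\<dots> \<le> 1 * (1 - r\<^sup>2)"
    unfolding div_by_1 using r by (intro mult_right_mono) (auto simp: power_le_one)
  finally have "r \<le> norm (\<phi> \<zeta>)"
    using power2_le_imp_le[of r "norm (\<phi> \<zeta>)"] by simp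
  moreover have "norm (1 - \<phi> \<zeta>) \<le> 3 * norm (1 - a)"
  proof -
    have "\<phi> \<zeta> - a = u * (\<zeta> * of_real (1 - s\<^sup>2) / (1 + of_real s * \<zeta>))"
      using nz[OF \<zeta>(1)] by (simp add: \<phi>_def a_eq field_simps power2_eq_square)
    then have "norm (\<phi> \<zeta> - a) = r * (1 - s\<^sup>2) / norm (1 + of_real s * \<zeta>)"
      using s by (simp add: norm_mult norm_divide u \<zeta> abs_square_le_1 del: of_real_diff)
    also have "\<dots> \<le> 1 * (1 - s\<^sup>2) / 1"
      using denom s r by (intro frac_le mult_right_mono) (auto simp: abs_square_le_1)
    also have "\<dots> = (1 + s) * (1 - s)"
      by (simp add: power2_eq_square algebra_simps)
    also have "\<dots> \<le> 2 * (1 - s)"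
      using s by (intro mult_right_mono) auto
    also have "1 - s \<le> norm (1 - a)"
      using norm_triangle_ineq2[of 1 a] by (simp add: s_def)
    finally have "norm (\<phi> \<zeta> - a) \<le> 2 * norm (1 - a)" by simp
    moreover have "norm (1 - \<phi> \<zeta>) \<le> norm (1 - a) + norm (\<phi> \<zeta> - a)"
      using norm_triangle_ineq4[of "1 - a" "\<phi> \<zeta> - a"] by simp
    ultimately show ?thesis by simp
  qed
  ultimately show ?thesis
    using big \<phi>_ball[OF \<zeta>(1)] by blast
qed

subsection \<open>Weighted subsequence counts under deletion\<close>

text \<open>
  The total weight of the embeddings of \<open>w\<close> as a subsequence of \<open>y\<close> followed by infinitely many zeros,
  where every letter skipped before the last matched one has weight \<open>u\<close>; the geometric series over
  the padding is \<open>1 / (1 - u)\<close>. In \<open>start_sum\<close> the letters before the first matched one have weight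
  \<open>v\<close> instead, and the first matched letter must lie in \<open>y\<close> itself.
\<close>

fun embed_sum :: "complex \<Rightarrow> bool list \<Rightarrow> bool list \<Rightarrow> complex" where
  "embed_sum u [] y = 1"
| "embed_sum u (a # w) [] = (if a then 0 else embed_sum u w [] / (1 - u))"
| "embed_sum u (a # w) (b # y) = of_bool (a = b) * embed_sum u w y + u * embed_sum u (a # w) y"

text \<open>The contribution of one starting position. It makes \<open>start_sum\<close> a
  polynomial in \<open>v\<close> whose coefficients can be examined one at a time, each by a query
  on one window.\<close>

definition head_sum :: "complex \<Rightarrow> bool list \<Rightarrow> bool list \<Rightarrow> complex" where
  "head_sum u w y = of_bool (hd w = hd y) * embed_sum u (tl w) (tl y)"

definition start_sum :: "complex \<Rightarrow> complex \<Rightarrow> bool list \<Rightarrow> bool list \<Rightarrow> complex" where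
  "start_sum v u w y = (\<Sum>j<length y. v ^ j * head_sum u w (drop j y))"

lemma start_sum_Nil [simp]: "start_sum v u w [] = 0"
  by (simp add: start_sum_def)

lemma start_sum_Cons:
  "start_sum v u w (b # y) = of_bool (hd w = b) * embed_sum u (tl w) y + v * start_sum v u w y"
  by (simp add: start_sum_def head_sum_def sum.lessThan_Suc_shift sum_distrib_left mult_ac
      del: sum.lessThan_Suc)

text \<open>Each letter of \<open>w\<close> costs at most one geometric series:
  \<open>C = 1 / (1 - norm u)\<close> is the fixed point of
  \<open>1 + norm u * C = C\<close>.\<close>

lemma norm_embed_sum_le:
  assumes "norm u < 1"
  shows "norm (embed_sum u w y) \<le> (1 / (1 - norm u)) ^ length w"
  using assms
proof (induction u w y rule: embed_sum.induct)
  case (2 u a w)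
  show ?case
  proof (cases a)
    case False
    have "1 - norm u \<le> norm (1 - u)"
      using norm_triangle_ineq2[of 1 u] by simp
    then have "norm (embed_sum u w [] / (1 - u)) \<le> (1 / (1 - norm u)) ^ length w / (1 - norm u)"
      unfolding norm_divide using 2 False by (intro frac_le) auto
    with False show ?thesis
      by simp
  qed (use 2 in simp)
next
  case (3 u a w b y)
  define C where "C = 1 / (1 - norm u)"
  have C: "1 + norm u * C = C"
    using 3 by (simp add: C_def field_simps)
  have "norm (embed_sum u (a # w) (b # y)) \<le> norm (of_bool (a = b) * embed_sum u w y) + norm (u * embed_sum u (a # w) y)"
    by (simp add: norm_triangle_ineq)
  also have "\<dots> \<le> C ^ length w + norm u * (C * C ^ length w)"
    unfolding C_def norm_mult using 3 by (intro add_mono mult_left_mono) auto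
  also have "\<dots> = (1 + norm u * C) * C ^ length w"
    by (simp add: algebra_simps)
  finally show ?case
    unfolding C by (simp add: C_def)
qed auto

lemma norm_head_sum_le:
  assumes "norm u < 1"
  shows "norm (head_sum u w y) \<le> (1 / (1 - norm u)) ^ (length w - 1)"
proof -
  have "norm (head_sum u w y) \<le> 1 * norm (embed_sum u (tl w) (tl y))"
    unfolding head_sum_def norm_mult by (intro mult_right_mono) auto
  also have "\<dots> \<le> (1 / (1 - norm u)) ^ length (tl w)"
    unfolding mult_1 by (rule norm_embed_sum_le[OF assms])
  finally show ?thesis by simp
qed

text \<open>The value on the empty list already solves the recursion for a leading zero, since 1 /
  (1 - u) = 1 + u / (1 - u).\<close>

lemma embed_sum_replicate_False:
  assumes "u \<noteq> 1"
  shows "embed_sum u w (replicate k False) = embed_sum u w []"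
proof (induction k arbitrary: w)
  case (Suc k)
  show ?case
    using assms by (cases w) (auto simp: Suc divide_simps, simp add: algebra_simps)
qed simp

lemma embed_sum_append_False:
  assumes "u \<noteq> 1"
  shows "embed_sum u w (y @ replicate k False) = embed_sum u w y"
proof (induction y arbitrary: w)
  case Nil
  then show ?case using embed_sum_replicate_False[OF assms] by simp
next
  case (Cons b y)
  then show ?case by (cases w) auto
qed

lemma start_sum_append_False:
  assumes "u \<noteq> 1"
  shows "start_sum v u w (y @ replicate k False) =
    start_sum v u w y + v ^ length y * start_sum v u w (replicate k False)"
  by (induction y) (auto simp: start_sum_Cons embed_sum_append_False[OF assms] algebra_simps)

text \<open>In the recursion a matched letter shortens \<open>w\<close>, gaining a factor 1/4
  through \<open>4 ^ length w\<close>, and a skipped letter costs at most 1/2. Together each further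
  letter of the window contracts the error by 1/4 + 1/2 = 3/4.\<close>

lemma norm_embed_sum_diff_take_le:
  assumes "norm u \<le> 1/2"
  shows "norm (embed_sum u w y - embed_sum u w (take L y)) \<le> 2 * (3/4) ^ L * 4 ^ length w"
proof (induction L arbitrary: w y)
  case 0
  have *: "norm (embed_sum u w y) \<le> 4 ^ length w" for y
  proof -
    have "norm (embed_sum u w y) \<le> (1 / (1 - norm u)) ^ length w"
      using assms by (intro norm_embed_sum_le) auto
    also have "\<dots> \<le> 4 ^ length w"
      using assms by (intro power_mono) (auto simp: field_simps)
    finally show ?thesis .
  qed
  show ?case
    using norm_triangle_ineq4[of "embed_sum u w y" "embed_sum u w []"] *[of y] *[of "[]"] by simp
next
  case (Suc L)
  show ?case
  proof (cases "w = [] \<or> y = []")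
    case False
    then obtain a v b z where wy: "w = a # v" "y = b # z"
      by (metis neq_Nil_conv)
    define d where "d w' = embed_sum u w' z - embed_sum u w' (take L z)" for w'
    have "embed_sum u w y - embed_sum u w (take (Suc L) y) = of_bool (a = b) * d v + u * d w"
      by (simp add: wy d_def algebra_simps)
    also have "norm \<dots> \<le> 1 * norm (d v) + (1/2) * norm (d w)"
    proof -
      have "norm (of_bool (a = b) * d v) \<le> 1 * norm (d v)"
        unfolding norm_mult by (intro mult_right_mono) auto
      moreover have "norm (u * d w) \<le> (1/2) * norm (d w)"
        unfolding norm_mult using assms by (intro mult_right_mono) auto
      ultimately show ?thesis
        using norm_triangle_ineq[of "of_bool (a = b) * d v" "u * d w"] by linarith
    qed
    also have "\<dots> \<le> 1 * (2 * (3/4) ^ L * 4 ^ length v) + (1/2) * (2 * (3/4) ^ L * 4 ^ length w)"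
      using Suc.IH[of v z] Suc.IH[of w z] unfolding d_def by (intro add_mono mult_left_mono) auto
    also have "\<dots> = 2 * (3/4) ^ Suc L * 4 ^ length w"
      by (simp add: wy)
    finally show ?thesis .
  qed auto
qed

lemma norm_head_sum_diff_take_le:
  assumes "norm u \<le> 1/2" and "y \<noteq> []"
  shows "norm (head_sum u w y - head_sum u w (take (Suc L) y)) \<le> 2 * (3/4) ^ L * 4 ^ length w"
proof -
  obtain b z where y: "y = b # z"
    using assms by (cases y) auto
  have "norm (head_sum u w y - head_sum u w (take (Suc L) y)) \<le>
      1 * norm (embed_sum u (tl w) z - embed_sum u (tl w) (take L z))"
    unfolding head_sum_def by (simp add: y norm_mult flip: right_diff_distrib)
  also have "\<dots> \<le> 2 * (3/4) ^ L * 4 ^ length (tl w)"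
    unfolding mult_1 by (rule norm_embed_sum_diff_take_le[OF assms(1)])
  also have "\<dots> \<le> 2 * (3/4) ^ L * 4 ^ length w"
    by (intro mult_left_mono power_increasing) auto
  finally show ?thesis .
qed

section \<open>Action of deletion on the weights\<close>

definition trace :: "real \<Rightarrow> bool list \<Rightarrow> bool list pmf" where
  "trace \<delta> x = map_pmf (\<lambda>keep. nths x {i. keep i})
     (Pi_pmf {..<length x} False (\<lambda>_. bernoulli_pmf (1 - \<delta>)))"

lemma Del_eq_trace: "Del \<delta> x = map_pmf (zero_pad (length x)) (trace \<delta> x)"
  by (simp add: Del_def trace_def map_pmf_comp)

lemma trace_Nil [simp]: "trace \<delta> [] = return_pmf []"
  by (simp add: trace_def)

lemma trace_Cons:
  "trace \<delta> (b # x) = bernoulli_pmf (1 - \<delta>) \<bind>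
     (\<lambda>k. map_pmf (\<lambda>y. if k then b # y else y) (trace \<delta> x))"
proof -
  let ?B = "\<lambda>_::nat. bernoulli_pmf (1 - \<delta>)"
  \<comment> \<open>Coordinate 0 decides whether \<open>b\<close> survives; the remaining
    coordinates are reindexed by \<open>Suc\<close>.\<close>
  have shift: "Pi_pmf {..<length x} False ?B = map_pmf (\<lambda>g. g \<circ> Suc) (Pi_pmf (Suc ` {..<length x}) False ?B)"
    by (rule Pi_pmf_bij_betw) (auto simp: bij_betw_def)
  have "Pi_pmf {..<length (b # x)} False ?B = Pi_pmf (insert 0 (Suc ` {..<length x})) False ?B"
    by (simp add: lessThan_Suc_eq_insert_0)
  also have "\<dots> = bernoulli_pmf (1 - \<delta>) \<bind>
      (\<lambda>k. map_pmf (\<lambda>f. f(0 := k)) (Pi_pmf (Suc ` {..<length x}) False ?B))"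
    by (subst Pi_pmf_insert') (auto simp: map_pmf_def)
  finally show ?thesis
    unfolding trace_def shift
    by (auto simp: map_bind_pmf map_pmf_comp nths_Cons o_def intro!: bind_pmf_cong map_pmf_cong)
qed

lemma finite_set_trace [simp]: "finite (set_pmf (trace \<delta> x))"
  by (induction x) (auto simp: trace_Cons)

lemma length_trace: "y \<in> set_pmf (trace \<delta> x) \<Longrightarrow> length y \<le> length x"
  by (induction x arbitrary: y) (force simp: trace_Cons split: if_splits)+

lemma expectation_trace_Cons:
  fixes f :: "bool list \<Rightarrow> complex"
  assumes "0 < \<delta>" "\<delta> < 1"
  shows "measure_pmf.expectation (trace \<delta> (b # x)) f =
    of_real \<delta> * measure_pmf.expectation (trace \<delta> x) f +
    of_real (1 - \<delta>) * measure_pmf.expectation (trace \<delta> x) (\<lambda>y. f (b # y))"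
  unfolding trace_Cons using assms
  by (subst pmf_expectation_bind[of UNIV]) (auto simp: UNIV_bool scaleR_conv_of_real)

lemma integrable_trace [simp]:
  fixes f :: "bool list \<Rightarrow> complex"
  shows "integrable (measure_pmf (trace \<delta> x)) f"
  by (intro integrable_measure_pmf_finite) simp

text \<open>Condition on the first source letter. It is matched only if it survives, which costs
  \<open>1 - \<delta>\<close>; otherwise it was deleted, with weight 1, or survived and was skipped,
  with weight \<open>u\<close>.\<close>

lemma expectation_embed_sum:
  assumes \<delta>: "0 < \<delta>" "\<delta> < 1" and "u \<noteq> 1"
  shows "measure_pmf.expectation (trace \<delta> x) (embed_sum u w) =
    of_real (1 - \<delta>) ^ length w * embed_sum (of_real \<delta> + of_real (1 - \<delta>) * u) w x"
proof (induction x arbitrary: w)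
  case Nil
  define z where "z = of_real \<delta> + of_real (1 - \<delta>) * u"
  \<comment> \<open>This makes the geometric series of the padding supply the factor
    \<open>1 - \<delta>\<close> for letters matched beyond the end.\<close>
  have z: "1 - z = of_real (1 - \<delta>) * (1 - u)"
    by (simp add: z_def algebra_simps)
  have nz: "complex_of_real (1 - \<delta>) \<noteq> 0" "1 - u \<noteq> 0"
    using assms by auto
  have "embed_sum u w [] = of_real (1 - \<delta>) ^ length w * embed_sum z w []"
    by (induction w) (use nz in \<open>auto simp: z divide_simps simp del: of_real_diff\<close>)
  then show ?case
    by (simp add: z_def)
next
  case (Cons b x)
  show ?case
  proof (cases w)
    case (Cons a v)
    let ?E = "measure_pmf.expectation (trace \<delta> x)"
    have "?E (\<lambda>y. embed_sum u w (b # y)) = of_bool (a = b) * ?E (embed_sum u v) + u * ?E (embed_sum u w)"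
      by (simp add: Cons)
    then show ?thesis
      by (simp add: expectation_trace_Cons[OF \<delta>] Cons.IH) (simp add: Cons algebra_simps)
  qed (simp add: expectation_trace_Cons[OF \<delta>])
qed

lemma expectation_start_sum:
  assumes \<delta>: "0 < \<delta>" "\<delta> < 1" and "u \<noteq> 1" and "w \<noteq> []"
  shows "measure_pmf.expectation (trace \<delta> x) (start_sum v u w) =
    of_real (1 - \<delta>) ^ length w *
      start_sum (of_real \<delta> + of_real (1 - \<delta>) * v) (of_real \<delta> + of_real (1 - \<delta>) * u) w x"
proof (induction x)
  case (Cons b x)
  let ?E = "measure_pmf.expectation (trace \<delta> x)"
  define p where "p = complex_of_real (1 - \<delta>)"
  define z where "z = of_real \<delta> + p * v"
  define e where "e = embed_sum (of_real \<delta> + p * u) (tl w) x"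
  define s where "s = start_sum z (of_real \<delta> + p * u) w x"
  have w: "length w = Suc (length (tl w))"
    using assms by (cases w) auto
  have E_start: "?E (start_sum v u w) = p * p ^ length (tl w) * s"
    unfolding Cons.IH w by (simp add: p_def s_def z_def)
  have E_embed: "?E (embed_sum u (tl w)) = p ^ length (tl w) * e"
    unfolding expectation_embed_sum[OF assms(1-3)] by (simp add: p_def e_def)
  have "?E (\<lambda>y. start_sum v u w (b # y)) =
      of_bool (hd w = b) * ?E (embed_sum u (tl w)) + v * ?E (start_sum v u w)"
    by (simp add: start_sum_Cons)
  then have "measure_pmf.expectation (trace \<delta> (b # x)) (start_sum v u w) =
      of_real \<delta> * (p * p ^ length (tl w) * s) +
      p * (of_bool (hd w = b) * (p ^ length (tl w) * e) + v * (p * p ^ length (tl w) * s))"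
    unfolding expectation_trace_Cons[OF \<delta>] E_start E_embed by (simp add: p_def)
  also have "\<dots> = p * p ^ length (tl w) * (of_bool (hd w = b) * e + z * s)"
    by (simp add: z_def algebra_simps)
  finally show ?case
    unfolding w start_sum_Cons by (simp add: e_def s_def p_def z_def)
qed simp

text \<open>The number of surviving letters is binomial, whatever the letters are. The induction
  varies \<open>g\<close> because a surviving letter shifts its argument.\<close>

lemma expectation_length_trace:
  fixes g :: "nat \<Rightarrow> complex"
  assumes \<delta>: "0 < \<delta>" "\<delta> < 1" and "length x = length x'"
  shows "measure_pmf.expectation (trace \<delta> x) (\<lambda>y. g (length y)) =
    measure_pmf.expectation (trace \<delta> x') (\<lambda>y. g (length y))"
  using assms(3)
proof (induction x x' arbitrary: g rule: list_induct2)
  case (Cons b x b' x')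
  from Cons.IH[of g] Cons.IH[of "\<lambda>n. g (Suc n)"] show ?case
    by (simp add: expectation_trace_Cons[OF \<delta>])
qed simp

lemma finite_set_Del [simp]: "finite (set_pmf (Del \<delta> x))"
  by (simp add: Del_eq_trace)

lemma length_Del: "y \<in> set_pmf (Del \<delta> x) \<Longrightarrow> length y = length x"
  using length_trace by (auto simp: Del_eq_trace zero_pad_def)

lemma integrable_Del [simp]:
  fixes f :: "bool list \<Rightarrow> 'a :: {banach, second_countable_topology}"
  shows "integrable (measure_pmf (Del \<delta> x)) f"
  by (intro integrable_measure_pmf_finite) simp

text \<open>The padding is invisible in the difference: it contributes a term that depends only on the
  length of the trace.\<close>

lemma expectation_start_sum_Del_diff:
  assumes \<delta>: "0 < \<delta>" "\<delta> < 1" and "u \<noteq> 1" and "w \<noteq> []" and "length x' = length x"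
  shows "measure_pmf.expectation (Del \<delta> x) (start_sum v u w) - measure_pmf.expectation (Del \<delta> x') (start_sum v u w) =
    of_real (1 - \<delta>) ^ length w *
      (start_sum (of_real \<delta> + of_real (1 - \<delta>) * v) (of_real \<delta> + of_real (1 - \<delta>) * u) w x -
       start_sum (of_real \<delta> + of_real (1 - \<delta>) * v) (of_real \<delta> + of_real (1 - \<delta>) * u) w x')"
proof -
  \<comment> \<open>The embeddings that start inside the padding, for a trace of length
    \<open>l\<close>.\<close>
  define g where "g l = v ^ l * start_sum v u w (replicate (length x - l) False)" for l
  have "measure_pmf.expectation (Del \<delta> z) (start_sum v u w) =
      measure_pmf.expectation (trace \<delta> z) (start_sum v u w) + measure_pmf.expectation (trace \<delta> z) (\<lambda>y. g (length y))"
    if "length z = length x" for z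
    by (simp add: Del_eq_trace zero_pad_def start_sum_append_False[OF assms(3)] that g_def)
  then show ?thesis
    using expectation_length_trace[OF \<delta>, of x x' g] assms
    by (simp add: expectation_start_sum[OF assms(1-4)] algebra_simps)
qed

section \<open>From a weighted count to a local query\<close>

lemma abs_expectation_diff_ge_Re_or_Im:
  fixes t :: "bool list \<Rightarrow> complex"
  assumes "D \<le> norm (measure_pmf.expectation (Del \<delta> x) t - measure_pmf.expectation (Del \<delta> x') t)"
  shows "\<exists>P\<in>{Re, Im}. D / 2 \<le> \<bar>measure_pmf.expectation (Del \<delta> x) (\<lambda>y. P (t y)) - measure_pmf.expectation (Del \<delta> x') (\<lambda>y. P (t y))\<bar>"
  using assms cmod_le[of "measure_pmf.expectation (Del \<delta> x) t - measure_pmf.expectation (Del \<delta> x') t"]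
  by (auto simp: integral_Re integral_Im)

text \<open>A window starting near the end of the string would leave it. Its start is therefore
  moved left to \<open>i\<close>, and the query itself discards the first \<open>j - i\<close>
  letters.\<close>

lemma window_in_range:
  assumes "length y = n" and "j < n" and "l = min n (Suc L)" and "i = min j (n - l)"
  shows "take (Suc L) (drop (j - i) (take l (drop i y))) = take (Suc L) (drop j y)"
proof -
  have "take (Suc L) (drop (j - i) (take l (drop i y))) = take (min (Suc L) (l - (j - i))) (drop j y)"
    by (simp add: drop_take assms)
  moreover have "min (Suc L) (l - (j - i)) = Suc L \<or> min (Suc L) (l - (j - i)) = n - j \<and> n - j \<le> Suc L"
    using assms by (auto simp: min_def split: if_splits)
  ultimately show ?thesis
    using assms(1) by auto
qed

text \<open>The expectation of \<open>start_sum\<close> is a sum over starting positions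
  \<open>j\<close> of \<open>v ^ j\<close> times the expectation of \<open>head_sum\<close> there,
  so a large difference forces a difference \<open>D\<close> at one position. Truncating the suffix
  at that position to \<open>Suc L\<close> letters and taking a real or imaginary part keep a
  quarter of it.\<close>

lemma distinguishing_query:
  assumes \<delta>: "0 < \<delta>" "\<delta> < 1" and x: "length x = n" "length x' = n" and "0 < n" and "w \<noteq> []"
    and u: "norm u \<le> 1/2" and V: "\<And>j. j < n \<Longrightarrow> norm v ^ j \<le> V" and "0 < V"
    and gap: "\<epsilon> \<le> norm (start_sum (of_real \<delta> + of_real (1 - \<delta>) * v) (of_real \<delta> + of_real (1 - \<delta>) * u) w x -
       start_sum (of_real \<delta> + of_real (1 - \<delta>) * v) (of_real \<delta> + of_real (1 - \<delta>) * u) w x')"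
    and D: "D = (1 - \<delta>) ^ length w * \<epsilon> / (real n * V)"
    and trunc: "2 * (3/4) ^ L * 4 ^ length w \<le> D / 4"
  shows "\<exists>q. local_query n (min n (Suc L)) q \<and>
    D / (4 * 2 ^ length w) \<le> \<bar>measure_pmf.expectation (Del \<delta> x) q - measure_pmf.expectation (Del \<delta> x') q\<bar>"
proof -
  let ?E = "\<lambda>z f. measure_pmf.expectation (Del \<delta> z) f"
  define h where "h j y = head_sum u w (drop j y)" for j y
  define t where "t j y = head_sum u w (take (Suc L) (drop j y))" for j y
  have "u \<noteq> 1"
    using u by auto
  have E_start: "?E z (start_sum v u w) = (\<Sum>j<n. v ^ j * ?E z (h j))" if "length z = n" for z
  proof -
    have "?E z (start_sum v u w) = ?E z (\<lambda>y. \<Sum>j<n. v ^ j * h j y)"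
      using length_Del that by (intro integral_cong_AE) (auto simp: AE_measure_pmf_iff start_sum_def h_def)
    then show ?thesis
      by simp
  qed
  \<comment> \<open>If all differences were below \<open>D\<close>, the weighted sum would stay
    below \<open>real n * V * D\<close>, which is the lower bound coming from
    \<open>gap\<close>.\<close>
  have "\<exists>j<n. D \<le> norm (?E x (h j) - ?E x' (h j))"
  proof (rule ccontr)
    assume "\<not> ?thesis"
    then have less: "norm (?E x (h j) - ?E x' (h j)) < D" if "j < n" for j
      using that by force
    have "norm (\<Sum>j<n. v ^ j * (?E x (h j) - ?E x' (h j))) \<le> (\<Sum>j<n. norm v ^ j * norm (?E x (h j) - ?E x' (h j)))"
      by (rule sum_norm_le) (simp add: norm_mult norm_power)
    also have "\<dots> < (\<Sum>j<n. V * D)"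
    proof (rule sum_strict_mono)
      fix j assume "j \<in> {..<n}"
      then have "norm v ^ j * norm (?E x (h j) - ?E x' (h j)) \<le> V * norm (?E x (h j) - ?E x' (h j))"
        using V by (intro mult_right_mono) auto
      also have "\<dots> < V * D"
        using less \<open>j \<in> {..<n}\<close> \<open>0 < V\<close> by (intro mult_strict_left_mono) auto
      finally show "norm v ^ j * norm (?E x (h j) - ?E x' (h j)) < V * D" .
    qed (use \<open>0 < n\<close> in auto)
    also have "\<dots> = (1 - \<delta>) ^ length w * \<epsilon>"
      using \<open>0 < n\<close> \<open>0 < V\<close> by (simp add: D)
    finally have "norm (?E x (start_sum v u w) - ?E x' (start_sum v u w)) < (1 - \<delta>) ^ length w * \<epsilon>"
      by (simp add: E_start x right_diff_distrib sum_subtractf)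
    moreover have "(1 - \<delta>) ^ length w * \<epsilon> \<le> norm (?E x (start_sum v u w) - ?E x' (start_sum v u w))"
      using expectation_start_sum_Del_diff[OF \<delta> \<open>u \<noteq> 1\<close> \<open>w \<noteq> []\<close>, of x' x v] x gap \<delta>
      by (simp add: norm_mult norm_power del: of_real_diff)
    ultimately show False by linarith
  qed
  then obtain j where j: "j < n" and Dj: "D \<le> norm (?E x (h j) - ?E x' (h j))"
    by blast
  have close: "norm (?E z (h j) - ?E z (t j)) \<le> D / 4" if "length z = n" for z
  proof -
    have "norm (?E z (\<lambda>y. h j y - t j y)) \<le> ?E z (\<lambda>y. norm (h j y - t j y))"
      by (rule integral_norm_bound)
    also have "\<dots> \<le> ?E z (\<lambda>_. D / 4)"
    proof (rule integral_mono_AE)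
      show "AE y in measure_pmf (Del \<delta> z). norm (h j y - t j y) \<le> D / 4"
      proof (intro AE_pmfI)
        fix y assume "y \<in> set_pmf (Del \<delta> z)"
        then have "drop j y \<noteq> []"
          using length_Del that j by simp
        from norm_head_sum_diff_take_le[OF u this, of w L] show "norm (h j y - t j y) \<le> D / 4"
          using trunc unfolding h_def t_def by linarith
      qed
    qed auto
    finally show ?thesis by simp
  qed
  \<comment> \<open>Truncation loses \<open>D / 4\<close> on either side.\<close>
  have "D / 2 \<le> norm (?E x (t j) - ?E x' (t j))"
  proof -
    have "norm (a' - b') \<le> norm (a - b) + norm (a' - a) + norm (b' - b)" for a a' b b' :: complex
      by norm
    from this[of "?E x (h j)" "?E x' (h j)" "?E x (t j)" "?E x' (t j)"] show ?thesis
      using Dj close[OF x(1)] close[OF x(2)] by linarith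
  qed
  from abs_expectation_diff_ge_Re_or_Im[OF this] obtain P where P: "P \<in> {Re, Im}"
    and DP: "D / 2 / 2 \<le> \<bar>?E x (\<lambda>y. P (t j y)) - ?E x' (\<lambda>y. P (t j y))\<bar>"
    by blast
  \<comment> \<open>Normalises the query to [-1, 1]: for \<open>norm u \<le> 1/2\<close> the head
    sum is at most \<open>2 ^ (length w - 1)\<close>.\<close>
  define K where "K = (2::real) ^ length w"
  have K: "K > 0" by (simp add: K_def)
  define q where "q y = P (t j y) / K" for y
  define l where "l = min n (Suc L)"
  define i where "i = min j (n - l)"
  define q' where "q' z = P (head_sum u w (take (Suc L) (drop (j - i) z))) / K" for z
  have "q' z \<in> {-1..1}" for z
  proof -
    let ?a = "head_sum u w (take (Suc L) (drop (j - i) z))"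
    have "\<bar>P ?a\<bar> \<le> norm ?a"
      using P abs_Re_le_cmod abs_Im_le_cmod by auto
    also have "\<dots> \<le> (1 / (1 - norm u)) ^ (length w - 1)"
      using u by (intro norm_head_sum_le) auto
    also have "\<dots> \<le> 2 ^ (length w - 1)"
      using u by (intro power_mono) (auto simp: field_simps)
    also have "\<dots> \<le> K"
      unfolding K_def by (intro power_increasing) auto
    finally have "\<bar>q' z\<bar> \<le> 1"
      using K by (simp add: q'_def)
    then show ?thesis
      by (simp add: abs_le_iff)
  qed
  moreover have "q y = q' (take l (drop i y))" if "length y = n" for y
    unfolding q_def q'_def t_def using window_in_range[OF that j l_def i_def] by simp
  moreover have "i + l \<le> n"
    by (auto simp: i_def l_def)
  ultimately have "local_query n l q"
    unfolding local_query_def by blast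
  moreover have "D / (4 * 2 ^ length w) \<le> \<bar>?E x q - ?E x' q\<bar>"
  proof -
    have "?E x q - ?E x' q = (?E x (\<lambda>y. P (t j y)) - ?E x' (\<lambda>y. P (t j y))) / K"
      by (simp add: q_def[abs_def] diff_divide_distrib)
    then have "\<bar>?E x q - ?E x' q\<bar> = \<bar>?E x (\<lambda>y. P (t j y)) - ?E x' (\<lambda>y. P (t j y))\<bar> / K"
      using K by simp
    then show ?thesis
      using divide_right_mono[OF DP, of K] K by (simp add: K_def)
  qed
  ultimately show ?thesis
    unfolding l_def by blast
qed

lemma embed_sum_holomorphic: "(\<lambda>u. embed_sum u w y) holomorphic_on ball 0 1"
\<comment> \<open>The induction rule carries a weight argument; it is filled with a dummy because
  the weight is bound in the goal.\<close>
proof (induction "0::complex" w y rule: embed_sum.induct)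
  case (2 a w)
  then show ?case
    by (cases a) (auto intro!: holomorphic_intros)
next
  case (3 a w b y)
  then show ?case by (auto intro!: holomorphic_intros)
qed auto

lemma start_sum_holomorphic: "(\<lambda>u. start_sum v u w y) holomorphic_on ball 0 1"
  unfolding start_sum_def head_sum_def by (intro holomorphic_intros embed_sum_holomorphic)

lemma norm_start_sum_le:
  assumes "norm v \<le> 1" "norm u < 1"
  shows "norm (start_sum v u w y) \<le> real (length y) * (1 / (1 - norm u)) ^ length w"
proof -
  have "norm (start_sum v u w y) \<le> (\<Sum>j<length y. (1 / (1 - norm u)) ^ length w)"
    unfolding start_sum_def
  proof (rule sum_norm_le)
    fix j
    have "norm (v ^ j * head_sum u w (drop j y)) \<le> 1 * (1 / (1 - norm u)) ^ (length w - 1)"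
      unfolding norm_mult norm_power using assms by (intro mult_mono power_le_one norm_head_sum_le) auto
    also have "\<dots> \<le> (1 / (1 - norm u)) ^ length w"
      using assms by (simp add: power_increasing field_simps del: power_divide power_one_over)
    finally show "norm (v ^ j * head_sum u w (drop j y)) \<le> (1 / (1 - norm u)) ^ length w" .
  qed
  then show ?thesis by simp
qed

subsection \<open>Separating words\<close>

text \<open>Positions past the end read 0, in agreement with the infinite zero padding behind
  \<open>embed_sum\<close>.\<close>

definition bit_at :: "bool list \<Rightarrow> nat \<Rightarrow> bool" where
  "bit_at y k \<longleftrightarrow> k < length y \<and> y ! k"

definition occurs_at :: "bool list \<Rightarrow> bool list \<Rightarrow> nat \<Rightarrow> bool" where
  "occurs_at w y k \<longleftrightarrow> (\<forall>i<length w. w ! i = bit_at y (k + i))"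

lemma bit_at_Nil [simp]: "\<not> bit_at [] k"
  by (simp add: bit_at_def)

lemma bit_at_Cons_0 [simp]: "bit_at (b # y) 0 = b"
  by (simp add: bit_at_def)

lemma bit_at_Cons_Suc [simp]: "bit_at (b # y) (Suc k) = bit_at y k"
  by (simp add: bit_at_def)

lemma bit_at_drop: "j \<le> length y \<Longrightarrow> bit_at (drop j y) k = bit_at y (j + k)"
  by (auto simp: bit_at_def)

text \<open>With skip weight 0 only the embedding into consecutive positions from the start
  survives; it may run into the padding.\<close>

lemma embed_sum_0: "embed_sum 0 w y = of_bool (occurs_at w y 0)"
proof (induction "0::complex" w y rule: embed_sum.induct)
  case (2 a w)
  then show ?case
    by (cases a) (auto simp: occurs_at_def All_less_Suc2)
next
  case (3 a w b y)
  then show ?case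
    by (auto simp: occurs_at_def All_less_Suc2)
qed (auto simp: occurs_at_def)

lemma start_sum_0:
  assumes "w \<noteq> []"
  shows "start_sum v 0 w y = (\<Sum>k<length y. v ^ k * of_bool (occurs_at w y k))"
  unfolding start_sum_def
proof (intro sum.cong refl arg_cong2[where f = "(*)"])
  fix k assume "k \<in> {..<length y}"
  then obtain b z where y: "drop k y = b # z"
    by (cases "drop k y") auto
  have b: "bit_at y (k + i) = bit_at (b # z) i" for i
    using bit_at_drop[of k y i] \<open>k \<in> _\<close> by (simp add: y)
  obtain a u where w: "w = a # u"
    using assms by (cases w) auto
  show "head_sum 0 w (drop k y) = of_bool (occurs_at w y k)"
    by (auto simp: head_sum_def w y embed_sum_0 occurs_at_def b All_less_Suc2)
qed

section \<open>Words without short periods\<close>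

definition aperiodic :: "nat \<Rightarrow> bool list \<Rightarrow> bool" where
  "aperiodic m w \<longleftrightarrow> (\<forall>t. 0 < t \<longrightarrow> t \<le> m \<longrightarrow> (\<exists>k. k + t < length w \<and> w ! k \<noteq> w ! (k + t)))"

text \<open>Suppose the extensions by 0 and 1 had periods \<open>s\<close> and \<open>t\<close>. The
  last letters force \<open>v\<close> to be 0 at \<open>N - s\<close> and 1 at \<open>N - t\<close>,
  yet both equal the letter at \<open>N - s - t\<close>.\<close>

lemma aperiodic_extension:
  assumes "length v = 2 * m - 1" and "0 < m"
  shows "\<exists>b. aperiodic m (v @ [b])"
proof (rule ccontr)
  assume "\<not> ?thesis"
  then have "\<not> aperiodic m (v @ [False])" "\<not> aperiodic m (v @ [True])"
    by blast+
  moreover obtain N where N: "2 * m = Suc N" "length v = N"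
    using assms by (cases m) auto
  ultimately obtain s t where s: "0 < s" "s \<le> m" "\<And>k. k + s \<le> N \<Longrightarrow> (v @ [False]) ! k = (v @ [False]) ! (k + s)"
    and t: "0 < t" "t \<le> m" "\<And>k. k + t \<le> N \<Longrightarrow> (v @ [True]) ! k = (v @ [True]) ! (k + t)"
    unfolding aperiodic_def by (auto simp: less_Suc_eq_le)
  have le: "s \<le> N" "t \<le> N"
    using s t N by linarith+
  have less: "N - s < N" "N - t < N" "N - s - t < N"
    using s(1) t(1) le by linarith+
  have vs: "v ! (N - s) = False"
    using s(3)[of "N - s"] le less N by (simp add: nth_append)
  have vt: "v ! (N - t) = True"
    using t(3)[of "N - t"] le less N by (simp add: nth_append)
  have "s \<noteq> t"
    using vs vt by auto
  \<comment> \<open>Distinct periods of size at most \<open>m\<close> sum to at most 2m - 1, which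
    is \<open>N\<close>; so position \<open>N - s - t\<close> exists.\<close>
  then have st: "s + t \<le> N"
    using s t N by linarith
  then have eq: "N - s - t + s = N - t" "N - s - t + t = N - s"
    by linarith+
  have "v ! (N - s - t) = v ! (N - t)"
    using s(3)[of "N - s - t"] unfolding eq using less N by (simp add: nth_append)
  moreover have "v ! (N - s - t) = v ! (N - s)"
    using t(3)[of "N - s - t"] unfolding eq using less N by (simp add: nth_append)
  ultimately show False
    using vs vt by simp
qed

text \<open>Two occurrences at distance at most \<open>m\<close> agree on their overlap, which would
  make the distance a period of \<open>w\<close>.\<close>

lemma occurrences_separated:
  assumes "aperiodic m w" and "occurs_at w y k" and "occurs_at w y k'" and "k < k'"
  shows "k + m < k'"
proof (rule ccontr)
  assume "\<not> ?thesis"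
  then obtain i where i: "i + (k' - k) < length w" "w ! i \<noteq> w ! (i + (k' - k))"
    using assms(1,4) unfolding aperiodic_def by (metis add_diff_inverse_nat diff_is_0_eq le_diff_conv not_le not_less zero_less_diff add.commute)
  then have "w ! i = bit_at y (k' + i)" "w ! (i + (k' - k)) = bit_at y (k + (i + (k' - k)))"
    using assms(2,3) by (auto simp: occurs_at_def)
  moreover have "k + (i + (k' - k)) = k' + i"
    using assms(4) by simp
  ultimately have "w ! i = w ! (i + (k' - k))"
    by (simp only:)
  then show False
    using i(2) by contradiction
qed

lemma first_difference:
  assumes "length x = length x'" and "x \<noteq> x'"
  obtains i where "i < length x" "x ! i \<noteq> x' ! i" "\<And>k. k < i \<Longrightarrow> x ! k = x' ! k"
proof -
  have ex: "\<exists>i. i < length x \<and> x ! i \<noteq> x' ! i"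
    using assms nth_equalityI by blast
  define i where "i = (LEAST i. i < length x \<and> x ! i \<noteq> x' ! i)"
  have "i < length x \<and> x ! i \<noteq> x' ! i"
    unfolding i_def by (rule LeastI_ex[OF ex])
  moreover have "x ! k = x' ! k" if "k < i" for k
    using not_less_Least[of k] that calculation unfolding i_def by force
  ultimately show ?thesis
    using that by blast
qed

text \<open>The word consists of the 2m - 1 common letters before \<open>i\<close> and one chosen
  letter. Earlier occurrences read only positions before \<open>i\<close>, where the strings agree;
  at the last starting position the final letter is compared with the two different bits at
  \<open>i\<close>.\<close>

lemma separating_word:
  assumes x: "length x = length x'" and i: "i < length x" "x ! i \<noteq> x' ! i" "\<And>k. k < i \<Longrightarrow> x ! k = x' ! k"
    and "0 < m" and "2 * m - 1 \<le> i"
  obtains w where "length w = 2 * m" "aperiodic m w"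
    "\<And>k. k < i - (2 * m - 1) \<Longrightarrow> occurs_at w x k = occurs_at w x' k"
    "occurs_at w x (i - (2 * m - 1)) \<noteq> occurs_at w x' (i - (2 * m - 1))"
proof -
  define k0 where "k0 = i - (2 * m - 1)"
  have k0: "k0 + (2 * m - 1) = i"
    using assms by (simp add: k0_def)
  define v where "v = take (2 * m - 1) (drop k0 x)"
  have len: "length v = 2 * m - 1"
    using assms by (auto simp: v_def k0_def)
  then obtain b where b: "aperiodic m (v @ [b])"
    using aperiodic_extension \<open>0 < m\<close> by blast
  have bits: "bit_at x k = bit_at x' k" if "k < i" for k
    using that i x by (simp add: bit_at_def)
  have prefix: "v ! k = bit_at x (k0 + k)" if "k < 2 * m - 1" for k
  proof -
    have "k0 + k < length x"
      using that k0 i(1) by linarith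
    then show ?thesis
      using that by (simp add: v_def bit_at_def)
  qed
  have len_w: "length (v @ [b]) = Suc (2 * m - 1)"
    using len by simp
  have "occurs_at (v @ [b]) x k = occurs_at (v @ [b]) x' k" if "k < k0" for k
    unfolding occurs_at_def len_w using that k0 by (intro all_cong1 imp_cong refl) (simp add: bits)
  moreover have "occurs_at (v @ [b]) x k0 = (b = bit_at x i)"
    unfolding occurs_at_def len_w All_less_Suc using prefix len k0 by (simp add: nth_append)
  moreover have "occurs_at (v @ [b]) x' k0 = (b = bit_at x' i)"
    unfolding occurs_at_def len_w All_less_Suc using prefix len k0 bits by (simp add: nth_append)
  moreover have "bit_at x i \<noteq> bit_at x' i"
    using i x by (simp add: bit_at_def)
  ultimately show ?thesis
    using that[of "v @ [b]"] b len_w \<open>0 < m\<close> by (auto simp: k0_def)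
qed

section \<open>Generating functions of sparse occurrences\<close>

lemma norm_polynomial_le:
  fixes z :: complex
  assumes "\<And>k. norm (c k) \<le> 1" and "norm z \<le> 1"
  shows "norm (\<Sum>k<n. c k * z ^ k) \<le> real n"
proof -
  have "norm (\<Sum>k<n. c k * z ^ k) \<le> (\<Sum>k<n. 1)"
    by (rule sum_norm_le) (use assms in \<open>auto simp: norm_mult norm_power intro!: mult_le_one power_le_one\<close>)
  then show ?thesis by simp
qed

text \<open>Combines the two large-value lemmas with \<open>N = n\<close>; the fourth power and the
  factor \<open>real n ^ 3\<close> come from the four rotations of the second one.\<close>

lemma sparse_polynomial_large_value:
  fixes c :: "nat \<Rightarrow> complex"
  assumes c: "\<And>k. norm (c k) \<le> 1" and "c 0 = 1" and "0 < d" and "0 < m" and "0 < n"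
    and sparse: "\<And>k. 0 < k \<Longrightarrow> k \<le> m \<Longrightarrow> k \<noteq> d \<Longrightarrow> c k = 0"
    and deg: "\<And>k. n \<le> k \<Longrightarrow> c k = 0"
  shows "\<exists>z\<in>ball 0 1. 1 - 1 / (real n + 1) \<le> norm z \<and>
     norm (1 - z) \<le> 3 * (7 / real m ^ 2 * (5 + ln (2 * real m ^ 2))) \<and>
     exp (- (1 + (2 * real m * ln (4 * real m ^ 4 * real n) + 3) * ln (4 * real m ^ 2 * real n))) ^ 4
       \<le> norm (\<Sum>k<n. c k * z ^ k) * real n ^ 3"
proof -
  define f where "f z = (\<Sum>k<n. c k * z ^ k)" for z
  have holo: "f holomorphic_on ball 0 1"
    unfolding f_def by (intro holomorphic_intros)
  have bound: "norm (f z) \<le> real n" if "z \<in> ball 0 1" for z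
    unfolding f_def using that by (intro norm_polynomial_le c) auto
  have approx: "norm (f z - (1 + c d * z ^ d)) \<le> real n * norm z ^ m" if z: "z \<in> ball 0 1" for z
  proof -
    have one: "(1::complex) = (\<Sum>k<n. if k = 0 then 1 * z ^ k else 0)"
      using \<open>0 < n\<close> by simp
    \<comment> \<open>If \<open>d\<close> lies outside the range of summation, both sides vanish by
      \<open>deg\<close>.\<close>
    have dth: "c d * z ^ d = (\<Sum>k<n. if k = d then c k * z ^ k else 0)"
      using deg[of d] by auto
    have "f z - (1 + c d * z ^ d) = (\<Sum>k<n. c k * z ^ k - (if k = 0 then 1 * z ^ k else 0) - (if k = d then c k * z ^ k else 0))"
      unfolding sum_subtractf one[symmetric] dth[symmetric] f_def by simp
    also have "norm \<dots> \<le> (\<Sum>k<n. norm z ^ m)"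
    proof (rule sum_norm_le)
      fix k
      show "norm (c k * z ^ k - (if k = 0 then 1 * z ^ k else 0) - (if k = d then c k * z ^ k else 0)) \<le> norm z ^ m"
      proof (cases "k \<le> m \<or> k = d")
        case True
        then have "c k * z ^ k - (if k = 0 then 1 * z ^ k else 0) - (if k = d then c k * z ^ k else 0) = 0"
          using \<open>c 0 = 1\<close> sparse[of k] \<open>0 < d\<close> by auto
        then show ?thesis by simp
      next
        case False
        then have "norm (c k * z ^ k) \<le> 1 * norm z ^ m"
          unfolding norm_mult norm_power using z c by (intro mult_mono power_decreasing) auto
        then show ?thesis
          using False by simp
      qed
    qed
    finally show ?thesis by simp
  qed
  obtain a where a: "a \<in> ball 0 1" "norm (1 - a) \<le> 7 / real m ^ 2 * (5 + ln (2 * real m ^ 2))"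
    and fa: "exp (- (1 + (2 * real m * ln (4 * real m ^ 4 * real n) + 3) * ln (4 * real m ^ 2 * real n))) \<le> norm (f a)"
    using large_value_near_one[OF holo bound approx c \<open>0 < d\<close> \<open>0 < m\<close>] \<open>0 < n\<close> by auto
  obtain z where z: "z \<in> ball 0 1" "1 - 1 / (real n + 1) \<le> norm z" "norm (1 - z) \<le> 3 * norm (1 - a)"
    and fz: "norm (f a) ^ 4 \<le> norm (f z) * real n ^ 3"
    using large_value_near_circle[OF holo bound a(1), of "1 - 1 / (real n + 1)"] \<open>0 < n\<close> by (auto simp: field_simps)
  have "exp (- (1 + (2 * real m * ln (4 * real m ^ 4 * real n) + 3) * ln (4 * real m ^ 2 * real n))) ^ 4 \<le> norm (f a) ^ 4"
    using fa by (intro power_mono) auto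
  then have "exp (- (1 + (2 * real m * ln (4 * real m ^ 4 * real n) + 3) * ln (4 * real m ^ 2 * real n))) ^ 4 \<le> norm (f z) * real n ^ 3"
    using fz by linarith
  moreover have "norm (1 - z) \<le> 3 * (7 / real m ^ 2 * (5 + ln (2 * real m ^ 2)))"
    using z(3) a(2) by linarith
  ultimately show ?thesis
    using z(1,2) unfolding f_def by blast
qed

lemma polynomial_shift:
  fixes c :: "nat \<Rightarrow> complex"
  assumes "\<And>k. n \<le> k \<Longrightarrow> c k = 0" and "\<And>k. k < k0 \<Longrightarrow> c k = 0"
  shows "(\<Sum>k<n. c k * z ^ k) = z ^ k0 * (\<Sum>k<n. c (k0 + k) * z ^ k)"
proof -
  have "z ^ k0 * (\<Sum>k<n. c (k0 + k) * z ^ k) = (\<Sum>k\<in>{0..<n}. c (k + k0) * z ^ (k + k0))"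
    by (simp add: sum_distrib_left power_add mult_ac lessThan_atLeast0 add.commute)
  also have "\<dots> = (\<Sum>k\<in>{0 + k0..<n + k0}. c k * z ^ k)"
    by (rule sum.shift_bounds_nat_ivl[symmetric])
  also have "\<dots> = (\<Sum>k\<in>{..<n} \<inter> {k0..}. c k * z ^ k)"
    using assms(1) by (intro sum.mono_neutral_right) (auto simp: not_less)
  also have "\<dots> = (\<Sum>k<n. c k * z ^ k)"
    using assms(2) by (intro sum.mono_neutral_left) (auto simp: not_le)
  finally show ?thesis ..
qed

text \<open>1 - 1/(n + 1) is the inverse of 1 + 1/n, hence at least
  \<open>exp (- (1 / real n))\<close>.\<close>

lemma power_near_one_ge:
  fixes r :: real
  assumes "1 - 1 / (real n + 1) \<le> r" and "r \<le> 1" and "0 < n" and "k \<le> n"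
  shows "exp (- 1) \<le> r ^ k"
proof -
  have "1 + 1 / real n \<le> exp (1 / real n)"
    by (rule exp_ge_add_one_self)
  then have "exp (- (1 / real n)) \<le> 1 / (1 + 1 / real n)"
    unfolding exp_minus inverse_eq_divide by (intro divide_left_mono) (auto simp: add_pos_nonneg)
  also have "\<dots> = 1 - 1 / (real n + 1)"
    using \<open>0 < n\<close> by (simp add: field_simps)
  finally have "exp (- (1 / real n)) \<le> r"
    using assms(1) by linarith
  then have "exp (- (1 / real n)) ^ n \<le> r ^ n"
    by (intro power_mono) auto
  also have "\<dots> \<le> r ^ k"
    using assms(2,4) \<open>exp (- (1 / real n)) \<le> r\<close> less_le_trans[OF exp_gt_zero] by (intro power_decreasing) (auto intro: less_imp_le)
  finally show ?thesis
    using \<open>0 < n\<close> by (simp add: exp_of_nat_mult[symmetric])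
qed

text \<open>With inner weight 0 the difference of the statistics is a polynomial in the outer
  weight. Its lowest term is at \<open>k0\<close>, and aperiodicity leaves at most one further term
  among the next \<open>m\<close> coefficients.\<close>

lemma word_statistic_late_difference:
  assumes x: "length x = n" "length x' = n" and i: "i < n" "x ! i \<noteq> x' ! i" "\<And>k. k < i \<Longrightarrow> x ! k = x' ! k"
    and "0 < m" and "2 * m - 1 \<le> i"
  shows "\<exists>w z. length w = 2 * m \<and> z \<in> ball 0 1 \<and>
     norm (1 - z) \<le> 3 * (7 / real m ^ 2 * (5 + ln (2 * real m ^ 2))) \<and>
     exp (- 1) * exp (- (1 + (2 * real m * ln (4 * real m ^ 4 * real n) + 3) * ln (4 * real m ^ 2 * real n))) ^ 4
       \<le> norm (start_sum z 0 w x - start_sum z 0 w x') * real n ^ 3"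
proof -
  define k0 where "k0 = i - (2 * m - 1)"
  obtain w where w: "length w = 2 * m" "aperiodic m w"
    and before: "\<And>k. k < k0 \<Longrightarrow> occurs_at w x k = occurs_at w x' k"
    and at: "occurs_at w x k0 \<noteq> occurs_at w x' k0"
    using separating_word[of x x' i m] assms unfolding k0_def by (metis (no_types, lifting))
  have "0 < n" "k0 < n"
    using i by (auto simp: k0_def)
  have "w \<noteq> []"
    using w \<open>0 < m\<close> by auto
  define c :: "nat \<Rightarrow> complex" where
    "c k = (if k < n then of_bool (occurs_at w x k) - of_bool (occurs_at w x' k) else 0)" for k
  have diff: "start_sum z 0 w x - start_sum z 0 w x' = (\<Sum>k<n. c k * z ^ k)" for z
    unfolding start_sum_0[OF \<open>w \<noteq> []\<close>] x sum_subtractf[symmetric]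
    by (rule sum.cong) (auto simp: c_def algebra_simps)
  have c_le: "norm (c k) \<le> 1" for k
    by (auto simp: c_def)
  have c_deg: "c k = 0" if "n \<le> k" for k
    using that by (simp add: c_def)
  have c_before: "c k = 0" if "k < k0" for k
    using before[OF that] by (simp add: c_def)
  \<comment> \<open>The sign that normalises the lowest coefficient to 1.\<close>
  define \<sigma> where "\<sigma> = c k0"
  have \<sigma>: "\<sigma> * \<sigma> = 1" "norm \<sigma> = 1"
    using at \<open>k0 < n\<close> by (auto simp: \<sigma>_def c_def)
  \<comment> \<open>The string with an occurrence at \<open>k0\<close> has none among the next
    \<open>m\<close> positions; the other has at most one there, at \<open>d\<close>.\<close>
  have one_sided: "\<exists>d>0. \<forall>k. 0 < k \<longrightarrow> k \<le> m \<longrightarrow> k \<noteq> d \<longrightarrow> \<not> occurs_at w y (k0 + k) \<and> \<not> occurs_at w y' (k0 + k)"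
    if "occurs_at w y k0" for y y'
  proof -
    have y: "\<not> occurs_at w y (k0 + k)" if "0 < k" "k \<le> m" for k
      using occurrences_separated[OF w(2) \<open>occurs_at w y k0\<close>, of "k0 + k"] that by auto
    show ?thesis
    proof (cases "\<exists>d. 0 < d \<and> d \<le> m \<and> occurs_at w y' (k0 + d)")
      case True
      then obtain d where d: "0 < d" "d \<le> m" "occurs_at w y' (k0 + d)"
        by blast
      have "\<not> occurs_at w y' (k0 + k)" if "0 < k" "k \<le> m" "k \<noteq> d" for k
        using occurrences_separated[OF w(2) d(3), of "k0 + k"]
          occurrences_separated[OF w(2) _ d(3), of "k0 + k"] that d by (cases "k < d") auto
      then show ?thesis
        using y d(1) by blast
    next
      \<comment> \<open>Without any such occurrence the default \<open>d = 1\<close> serves.\<close>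
      case False
      then show ?thesis
        using y by (intro exI[of _ 1]) auto
    qed
  qed
  obtain d where d: "0 < d" "\<And>k. 0 < k \<Longrightarrow> k \<le> m \<Longrightarrow> k \<noteq> d \<Longrightarrow> c (k0 + k) = 0"
  proof (cases "occurs_at w x k0")
    case True
    from one_sided[OF this, of x'] show ?thesis
      using that by (auto simp: c_def)
  next
    case False
    then have "occurs_at w x' k0"
      using at by simp
    from one_sided[OF this, of x] show ?thesis
      using that by (auto simp: c_def)
  qed
  obtain z where z: "z \<in> ball 0 1" "1 - 1 / (real n + 1) \<le> norm z"
     "norm (1 - z) \<le> 3 * (7 / real m ^ 2 * (5 + ln (2 * real m ^ 2)))"
    and big: "exp (- (1 + (2 * real m * ln (4 * real m ^ 4 * real n) + 3) * ln (4 * real m ^ 2 * real n))) ^ 4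
       \<le> norm (\<Sum>k<n. \<sigma> * c (k0 + k) * z ^ k) * real n ^ 3"
    using sparse_polynomial_large_value[of "\<lambda>k. \<sigma> * c (k0 + k)" d m n] d \<open>0 < m\<close> \<open>0 < n\<close> c_le c_deg \<sigma>
    by (auto simp: norm_mult \<sigma>_def)
  have "norm (\<Sum>k<n. \<sigma> * c (k0 + k) * z ^ k) = norm (\<Sum>k<n. c (k0 + k) * z ^ k)"
    using \<sigma>(2) by (simp add: mult.assoc norm_mult flip: sum_distrib_left)
  moreover have "norm (start_sum z 0 w x - start_sum z 0 w x') = norm z ^ k0 * norm (\<Sum>k<n. c (k0 + k) * z ^ k)"
    using polynomial_shift[of n c k0 z] c_deg c_before unfolding diff by (simp add: norm_mult norm_power)
  moreover have "exp (- 1) \<le> norm z ^ k0"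
    using z \<open>0 < n\<close> \<open>k0 < n\<close> by (intro power_near_one_ge[of n]) auto
  ultimately have "exp (- 1) * exp (- (1 + (2 * real m * ln (4 * real m ^ 4 * real n) + 3) * ln (4 * real m ^ 2 * real n))) ^ 4
       \<le> norm (start_sum z 0 w x - start_sum z 0 w x') * real n ^ 3"
    using mult_mono[OF _ big, of "exp (- 1)" "norm z ^ k0"] by (simp add: mult.assoc)
  then show ?thesis
    using w(1) z by blast
qed

text \<open>On the circle of radius \<open>\<delta>\<close> the sample point at index 0 has angle at
  most 2 pi / \<open>J\<close>, hence lies within \<open>(1 - \<delta>) / 2\<close> of
  \<open>\<delta>\<close>; this is what the size of \<open>J\<close> is chosen for. Solving for
  \<open>u\<close> gives modulus at most 1/2, and \<open>B\<close> bounds the other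
  \<open>J - 1\<close> factors.\<close>

lemma large_value_in_disc:
  fixes f :: "complex \<Rightarrow> complex"
  assumes holo: "f holomorphic_on ball 0 1" and \<delta>: "0 < \<delta>" "\<delta> < 1" and J: "4 * pi / (1 - \<delta>) \<le> real J"
    and bound: "\<And>z. norm z = \<delta> \<Longrightarrow> norm (f z) \<le> B"
  shows "\<exists>u. norm u \<le> 1/2 \<and> norm (of_real \<delta> + of_real (1 - \<delta>) * u) = \<delta> \<and>
    norm (f 0) ^ J \<le> norm (f (of_real \<delta> + of_real (1 - \<delta>) * u)) * B ^ (J - 1)"
proof -
  have "0 < 4 * pi / (1 - \<delta>)"
    using \<delta> by simp
  then have "0 < J"
    using J by (cases J) auto
  obtain \<theta> where \<theta>: "0 \<le> \<theta>" "\<theta> \<le> 2*pi/real J"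
    and prod: "norm (f 0) ^ J \<le> (\<Prod>j<J. norm (f (of_real \<delta> * cis (\<theta> + 2*pi*real j/real J))))"
    using rotation_max_modulus[OF holo \<delta> \<open>0 < J\<close>] by blast
  define z where "z j = of_real \<delta> * cis (\<theta> + 2*pi*real j/real J)" for j
  define u where "u = (z 0 - of_real \<delta>) / of_real (1 - \<delta>)"
  have "complex_of_real (1 - \<delta>) \<noteq> 0"
    using \<delta> by (simp del: of_real_diff)
  then have u: "of_real \<delta> + of_real (1 - \<delta>) * u = z 0"
    by (simp add: u_def del: of_real_diff)
  have norm_z: "norm (z j) = \<delta>" for j
    using \<delta> by (simp add: z_def norm_mult)
  obtain J' where J': "J = Suc J'"
    using \<open>0 < J\<close> by (cases J) auto
  have "norm (f 0) ^ J \<le> (\<Prod>j<J. norm (f (z j)))"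
    using prod by (simp add: z_def)
  also have "\<dots> = norm (f (z 0)) * (\<Prod>j<J'. norm (f (z (Suc j))))"
    unfolding J' prod.lessThan_Suc_shift ..
  also have "\<dots> \<le> norm (f (z 0)) * (\<Prod>j<J'. B)"
    using bound[OF norm_z] by (intro mult_left_mono prod_mono) auto
  finally have "norm (f 0) ^ J \<le> norm (f (z 0)) * B ^ (J - 1)"
    by (simp add: J')
  moreover have "norm u \<le> 1/2"
  proof -
    have "norm (1 - cis \<theta>) \<le> norm (\<i> * of_real \<theta>)"
      using norm_one_minus_exp_le[of "- (\<i> * of_real \<theta>)"] by (simp add: cis_conv_exp)
    then have "norm (cis \<theta> - 1) \<le> \<theta>"
      using \<theta> by (simp add: norm_mult norm_minus_commute)
    moreover have "z 0 - of_real \<delta> = of_real \<delta> * (cis \<theta> - 1)"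
      by (simp add: z_def algebra_simps)
    then have "norm (z 0 - of_real \<delta>) = \<delta> * norm (cis \<theta> - 1)"
      using \<delta> by (simp add: norm_mult)
    moreover have "\<delta> * norm (cis \<theta> - 1) \<le> 1 * norm (cis \<theta> - 1)"
      using \<delta> by (intro mult_right_mono) auto
    moreover have "2*pi/real J \<le> (1 - \<delta>) / 2"
      using J \<delta> \<open>0 < J\<close> by (simp add: field_simps)
    ultimately have "norm (z 0 - of_real \<delta>) \<le> (1 - \<delta>) / 2"
      using \<theta> by linarith
    then show ?thesis
      using \<delta> by (simp add: u_def norm_divide field_simps del: of_real_diff)
  qed
  ultimately show ?thesis
    using u norm_z[of 0] by (intro exI[of _ u]) simp
qed

subsection \<open>Local queries and the algorithm\<close>

text \<open>This size balances two losses: m log^2 n in the exponent of the large value, and n (log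
  n / m^2)^2 from outer weights of modulus above 1. The second is of the order of the first once n
  is at most m^5.\<close>

definition block :: "nat \<Rightarrow> nat" where
  "block n = nat \<lceil>real n powr (1/5)\<rceil>"

text \<open>The common unit for all exponents. The shift by 2 makes the logarithm at least 1 for
  every positive \<open>n\<close>.\<close>

definition rate :: "nat \<Rightarrow> real" where
  "rate n = real (block n) * (ln (real n + 2))\<^sup>2"

lemma block_le: "real (block n) \<le> real n powr (1/5) + 1"
proof -
  have "0 \<le> \<lceil>real n powr (1/5)\<rceil>"
    by (simp add: less_le_trans[of _ 0])
  then show ?thesis
    unfolding block_def by (simp only: of_nat_nat) linarith
qed

lemma block_bounds:
  assumes "0 < n"
  shows "0 < block n" "block n \<le> n" "real n \<le> real (block n) ^ 5"
proof -
  have "0 < real n powr (1/5)"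
    using assms by simp
  then show pos: "0 < block n"
    by (simp add: block_def)
  have "real n powr (1/5) \<le> real n powr 1"
    using assms by (intro powr_mono) auto
  then show "block n \<le> n"
    using assms by (simp add: block_def ceiling_le_iff)
  have "real n = (real n powr (1/5)) powr 5"
    using assms by (simp add: powr_powr)
  also have "\<dots> \<le> real (block n) powr 5"
    unfolding block_def by (intro powr_mono2) auto
  also have "\<dots> = real (block n) ^ 5"
    using pos by (simp add: powr_realpow)
  finally show "real n \<le> real (block n) ^ 5" .
qed

lemma ln_add_2_ge_1:
  assumes "0 < n"
  shows "1 \<le> ln (real n + 2)"
  using assms exp_le by (subst ln_ge_iff) auto

lemma rate_bounds:
  assumes "0 < n"
  shows "1 \<le> rate n" "real (block n) \<le> rate n" "ln (real n + 2) \<le> rate n"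
proof -
  have m: "1 \<le> real (block n)"
    using block_bounds[OF assms] by simp
  note Y = ln_add_2_ge_1[OF assms]
  have Y2: "ln (real n + 2) \<le> (ln (real n + 2))\<^sup>2"
    using Y by (simp add: power2_eq_square)
  have "real (block n) * 1 \<le> rate n"
    unfolding rate_def using Y Y2 by (intro mult_left_mono) auto
  then show "real (block n) \<le> rate n" "1 \<le> rate n"
    using m by auto
  have "1 * (ln (real n + 2))\<^sup>2 \<le> rate n"
    unfolding rate_def using m by (intro mult_right_mono) auto
  then show "ln (real n + 2) \<le> rate n"
    using Y2 by simp
qed

text \<open>After division by the \<open>i\<close>-th power of the weight, the difference has
  modulus 1 at 0. Restoring that power on the circle of radius \<open>\<delta>\<close> costs
  \<open>\<delta> ^ i\<close>, which is affordable for early differences.\<close>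

lemma bit_statistic_difference:
  assumes \<delta>: "0 < \<delta>" "\<delta> < 1" and J: "4 * pi / (1 - \<delta>) \<le> real J"
    and x: "length x = n" "length x' = n" and i: "i < n" "x ! i \<noteq> x' ! i" "\<And>k. k < i \<Longrightarrow> x ! k = x' ! k"
  shows "\<exists>u. norm u \<le> 1/2 \<and>
     \<delta> ^ i \<le> norm (start_sum (of_real \<delta> + of_real (1 - \<delta>) * u) z [True] x -
       start_sum (of_real \<delta> + of_real (1 - \<delta>) * u) z [True] x') * real n ^ (J - 1)"
proof -
  define c :: "nat \<Rightarrow> complex" where
    "c k = (if k < n then of_bool (x ! k) - of_bool (x' ! k) else 0)" for k
  have start: "start_sum v z [True] y = (\<Sum>k<n. v ^ k * of_bool (y ! k))" if "length y = n" for v y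
    unfolding start_sum_def that
    by (rule sum.cong) (use that in \<open>auto simp: head_sum_def hd_drop_conv_nth\<close>)
  have diff: "start_sum v z [True] x - start_sum v z [True] x' = (\<Sum>k<n. c k * v ^ k)" for v
    unfolding start[OF x(1)] start[OF x(2)] sum_subtractf[symmetric]
    by (rule sum.cong) (auto simp: c_def algebra_simps)
  define f where "f v = (\<Sum>k<n. c (i + k) * v ^ k)" for v
  have f: "start_sum v z [True] x - start_sum v z [True] x' = v ^ i * f v" for v
    unfolding diff f_def using i by (intro polynomial_shift) (auto simp: c_def)
  have holo: "f holomorphic_on ball 0 1"
    unfolding f_def by (intro holomorphic_intros)
  have "f 0 = c i"
    using i(1) unfolding f_def by (cases n) (auto simp: sum.lessThan_Suc_shift simp del: sum.lessThan_Suc)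
  then have "norm (f 0) = 1"
    using i by (auto simp: c_def)
  moreover have "norm (f v) \<le> real n" if "norm v = \<delta>" for v
    unfolding f_def using that \<delta> by (intro norm_polynomial_le) (auto simp: c_def)
  ultimately obtain u where u: "norm u \<le> 1/2" "norm (of_real \<delta> + of_real (1 - \<delta>) * u) = \<delta>"
    "1 \<le> norm (f (of_real \<delta> + of_real (1 - \<delta>) * u)) * real n ^ (J - 1)"
    using large_value_in_disc[OF holo \<delta> J, of "real n"] by auto
  have "\<delta> ^ i * 1 \<le> \<delta> ^ i * (norm (f (of_real \<delta> + of_real (1 - \<delta>) * u)) * real n ^ (J - 1))"
    using u(3) \<delta> by (intro mult_left_mono) auto
  then show ?thesis
    using u(1,2) unfolding f by (intro exI[of _ u]) (simp add: norm_mult norm_power mult.assoc del: of_real_diff)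
qed

text \<open>Here \<open>v\<close> is the trace weight that deletion turns into \<open>z\<close>; it
  may leave the unit disc. As \<open>1 - z\<close> has positive real part, the first-order term of
  the squared modulus only helps, and the excess over 1 is quadratic in the distance to 1.\<close>

lemma norm_weight_power_le:
  fixes z v :: complex
  assumes "0 < p" and z: "z \<in> ball 0 1" "norm (1 - z) \<le> W" and v: "v = 1 - (1 - z) / of_real p" and "j \<le> n"
  shows "norm v ^ j \<le> exp (real n * (W\<^sup>2 / p\<^sup>2))"
proof -
  define a where "a = (1 - z) / of_real p"
  have "Re z < 1"
    using one_minus_ball(1)[OF z(1)] by simp
  then have "0 \<le> Re a"
    using \<open>0 < p\<close> by (simp add: a_def)
  have "(norm v)\<^sup>2 = 1 - 2 * Re a + (norm a)\<^sup>2"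
    unfolding v a_def[symmetric] cmod_power2 by (simp add: power2_eq_square algebra_simps)
  also have "\<dots> \<le> 1 + (norm a)\<^sup>2"
    using \<open>0 \<le> Re a\<close> by simp
  also have "(norm a)\<^sup>2 \<le> W\<^sup>2 / p\<^sup>2"
    using z(2) \<open>0 < p\<close> unfolding a_def norm_divide power_divide
    by (intro frac_le power_mono) auto
  finally have v2: "(norm v)\<^sup>2 \<le> 1 + W\<^sup>2 / p\<^sup>2"
    by simp
  have "norm v \<le> 1 + W\<^sup>2 / p\<^sup>2"
  proof (cases "norm v \<le> 1")
    case True
    then show ?thesis
      by (rule order_trans) simp
  next
    case False
    then have "norm v \<le> (norm v)\<^sup>2"
      using mult_left_mono[of 1 "norm v" "norm v"] by (simp add: power2_eq_square)
    then show ?thesis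
      using v2 by linarith
  qed
  then have "norm v \<le> exp (W\<^sup>2 / p\<^sup>2)"
    using exp_ge_add_one_self order_trans by blast
  then have "norm v ^ j \<le> exp (W\<^sup>2 / p\<^sup>2) ^ j"
    by (intro power_mono) auto
  also have "\<dots> \<le> exp (W\<^sup>2 / p\<^sup>2) ^ n"
    using \<open>j \<le> n\<close> by (intro power_increasing) auto
  finally show ?thesis
    by (simp only: exp_of_nat_mult)
qed

text \<open>With ln 4 at most 2 and all logarithms at most \<open>Y\<close>, the two large
  logarithms are at most 7 \<open>Y\<close> and 5 \<open>Y\<close>, so 344 = 4 (1 + (2 * 7 + 3) *
  5). In the second bound 28224 is the square of 3 * 7 * 8.\<close>

lemma late_difference_exponents:
  assumes "0 < n"
  defines "m \<equiv> block n" and "Y \<equiv> ln (real n + 2)"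
  shows "4 * (1 + (2 * real m * ln (4 * real m ^ 4 * real n) + 3) * ln (4 * real m ^ 2 * real n)) \<le> 344 * rate n"
    and "real n * (3 * (7 / real m ^ 2 * (5 + ln (2 * real m ^ 2))))\<^sup>2 \<le> 28224 * rate n"
proof -
  have m: "0 < m" "m \<le> n" "real n \<le> real m ^ 5" "1 \<le> real m"
    using block_bounds[OF \<open>0 < n\<close>] by (auto simp: m_def)
  have Y: "1 \<le> Y"
    using ln_add_2_ge_1[OF \<open>0 < n\<close>] by (simp add: Y_def)
  have lnn: "ln (real n) \<le> Y" and lnm: "ln (real m) \<le> Y" "0 \<le> ln (real m)" "0 \<le> ln (real n)"
    using m \<open>0 < n\<close> by (auto simp: Y_def)
  have ln4: "ln 4 \<le> (2::real)" "0 \<le> ln (4::real)"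
    using ln_2_less_1 ln_realpow[of 2 2] by auto
  have A: "ln (4 * real m ^ 4 * real n) \<le> 7 * Y" "0 \<le> ln (4 * real m ^ 4 * real n)"
    using m \<open>0 < n\<close> lnn lnm ln4 Y by (auto simp: ln_mult ln_realpow)
  have B: "ln (4 * real m ^ 2 * real n) \<le> 5 * Y" "0 \<le> ln (4 * real m ^ 2 * real n)"
    using m \<open>0 < n\<close> lnn lnm ln4 Y by (auto simp: ln_mult ln_realpow)
  have mY: "1 \<le> real m * Y" "1 \<le> real m * Y\<^sup>2"
    using mult_mono[of 1 "real m" 1 Y] mult_mono[of 1 "real m" 1 "Y\<^sup>2"] m(4) Y by (auto simp: one_le_power)
  have "(2 * real m * ln (4 * real m ^ 4 * real n) + 3) * ln (4 * real m ^ 2 * real n) \<le> (17 * (real m * Y)) * (5 * Y)"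
  proof (intro mult_mono)
    have "2 * real m * ln (4 * real m ^ 4 * real n) \<le> 2 * real m * (7 * Y)"
      using A m by (intro mult_left_mono) auto
    then show "2 * real m * ln (4 * real m ^ 4 * real n) + 3 \<le> 17 * (real m * Y)"
      using mY by (simp add: algebra_simps)
  qed (use B Y mY in auto)
  also have "\<dots> = 85 * rate n"
    by (simp add: rate_def m_def Y_def power2_eq_square)
  finally show "4 * (1 + (2 * real m * ln (4 * real m ^ 4 * real n) + 3) * ln (4 * real m ^ 2 * real n)) \<le> 344 * rate n"
    using rate_bounds(1)[OF \<open>0 < n\<close>] by simp
  have "5 + ln (2 * real m ^ 2) \<le> 8 * Y"
    using m lnm Y ln_2_less_1 by (simp add: ln_mult ln_realpow)
  moreover have "0 \<le> ln (2 * real m ^ 2)"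
    using one_le_power[OF m(4), of 2] by (intro ln_ge_zero) auto
  ultimately have "3 * (7 / real m ^ 2 * (5 + ln (2 * real m ^ 2))) \<le> 3 * (7 / real m ^ 2 * (8 * Y))"
    by (intro mult_left_mono) auto
  then have "(3 * (7 / real m ^ 2 * (5 + ln (2 * real m ^ 2))))\<^sup>2 \<le> (3 * (7 / real m ^ 2 * (8 * Y)))\<^sup>2"
    using \<open>0 \<le> ln (2 * real m ^ 2)\<close> by (intro power_mono) auto
  then have "real n * (3 * (7 / real m ^ 2 * (5 + ln (2 * real m ^ 2))))\<^sup>2 \<le> real m ^ 5 * (3 * (7 / real m ^ 2 * (8 * Y)))\<^sup>2"
    using m by (intro mult_mono) auto
  also have "\<dots> = 28224 * rate n"
    using m by (simp add: rate_def m_def[symmetric] Y_def[symmetric] field_simps eval_nat_numeral)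
  finally show "real n * (3 * (7 / real m ^ 2 * (5 + ln (2 * real m ^ 2))))\<^sup>2 \<le> 28224 * rate n" .
qed

text \<open>Three moves: a large difference at inner weight 0, a shift of the inner weight to the
  circle of radius \<open>\<delta>\<close> by \<open>large_value_in_disc\<close>, and the choice of
  \<open>v\<close> so that deletion yields the outer weight \<open>z\<close>.\<close>

lemma late_statistic:
  assumes \<delta>: "0 < \<delta>" "\<delta> < 1" and J: "4 * pi / (1 - \<delta>) \<le> real J"
    and x: "length x = n" "length x' = n" and i: "i < n" "x ! i \<noteq> x' ! i" "\<And>k. k < i \<Longrightarrow> x ! k = x' ! k"
    and late: "2 * block n - 1 \<le> i"
  shows "\<exists>w u v. length w = 2 * block n \<and> norm u \<le> 1/2 \<and>
    (\<forall>j<n. norm v ^ j \<le> exp (28224 / (1 - \<delta>)\<^sup>2 * rate n)) \<and>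
    exp (- (real J * (350 + 2 * ln (1 / (1 - \<delta>))) * rate n)) \<le>
      norm (start_sum (of_real \<delta> + of_real (1 - \<delta>) * v) (of_real \<delta> + of_real (1 - \<delta>) * u) w x -
        start_sum (of_real \<delta> + of_real (1 - \<delta>) * v) (of_real \<delta> + of_real (1 - \<delta>) * u) w x')"
proof -
  define m where "m = block n"
  define W where "W = 3 * (7 / real m ^ 2 * (5 + ln (2 * real m ^ 2)))"
  \<comment> \<open>348 adds to 344 a 3 for \<open>real n ^ 3\<close> and a 1 for
    \<open>exp (- 1)\<close>. \<open>B\<close> absorbs 2, \<open>n\<close> and
    \<open>(1 / (1 - \<delta>)) ^ (2 * m)\<close>; its 2 raises 348 to the final 350.\<close>
  define \<epsilon> where "\<epsilon> = exp (- (348 * rate n))"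
  define B where "B = exp ((2 + 2 * ln (1 / (1 - \<delta>))) * rate n)"
  have "0 < n" using i by simp
  note r = rate_bounds[OF this] and mb = block_bounds[OF this, folded m_def]
  note ex = late_difference_exponents[OF \<open>0 < n\<close>, folded m_def]
  have p: "0 < 1 - \<delta>" "0 \<le> ln (1 / (1 - \<delta>))"
    using \<delta> by (auto intro!: ln_ge_zero)
  have n_le: "real n \<le> exp (rate n)"
  proof -
    have "real n \<le> exp (ln (real n + 2))" by simp
    also have "\<dots> \<le> exp (rate n)"
      using r(3) by (subst exp_le_cancel_iff)
    finally show ?thesis .
  qed
  obtain w z where w: "length w = 2 * m" and z: "z \<in> ball 0 1" "norm (1 - z) \<le> W"
    and big: "exp (- 1) * exp (- (1 + (2 * real m * ln (4 * real m ^ 4 * real n) + 3) * ln (4 * real m ^ 2 * real n))) ^ 4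
       \<le> norm (start_sum z 0 w x - start_sum z 0 w x') * real n ^ 3"
    using word_statistic_late_difference[OF x i mb(1)] late unfolding W_def m_def by blast
  define f where "f u = start_sum z u w x - start_sum z u w x'" for u
  have "\<epsilon> \<le> norm (f 0)"
  proof -
    have "exp (- (1 + 344 * rate n)) \<le> exp (- 1) * exp (- (1 + (2 * real m * ln (4 * real m ^ 4 * real n) + 3) * ln (4 * real m ^ 2 * real n))) ^ 4"
      using ex(1) by (simp add: exp_of_nat_mult[symmetric] exp_add[symmetric] algebra_simps)
    also have "\<dots> \<le> norm (f 0) * real n ^ 3"
      using big by (simp add: f_def)
    also have "\<dots> \<le> norm (f 0) * exp (rate n) ^ 3"
      using n_le by (intro mult_left_mono power_mono) auto
    also have "\<dots> = norm (f 0) * exp (3 * rate n)"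
      by (simp add: exp_of_nat_mult[symmetric])
    finally have "exp (- (1 + 344 * rate n)) * exp (- (3 * rate n)) \<le> norm (f 0) * exp (3 * rate n) * exp (- (3 * rate n))"
      by (intro mult_right_mono) auto
    then have "exp (- (347 * rate n) - 1) \<le> norm (f 0)"
      by (simp add: mult.assoc exp_add[symmetric])
    moreover have "\<epsilon> \<le> exp (- (347 * rate n) - 1)"
      using r by (simp add: \<epsilon>_def)
    ultimately show ?thesis by linarith
  qed
  have B: "norm (f u) \<le> B" if "norm u = \<delta>" for u
  proof -
    have "norm (f u) \<le> norm (start_sum z u w x) + norm (start_sum z u w x')"
      unfolding f_def by (rule norm_triangle_ineq4)
    also have "\<dots> \<le> real n * (1 / (1 - \<delta>)) ^ (2 * m) + real n * (1 / (1 - \<delta>)) ^ (2 * m)"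
      using norm_start_sum_le[of z u w x] norm_start_sum_le[of z u w x'] z that \<delta> x w by (intro add_mono) auto
    also have "\<dots> = 2 * real n * exp (real (2 * m) * ln (1 / (1 - \<delta>)))"
      using p by (subst exp_of_nat_mult) simp
    also have "\<dots> \<le> exp (rate n) * exp (rate n) * exp (2 * rate n * ln (1 / (1 - \<delta>)))"
    proof (intro mult_mono)
      have "1 + rate n \<le> exp (rate n)"
        by (rule exp_ge_add_one_self)
      then show "2 \<le> exp (rate n)"
        using r by linarith
      have "real (2 * m) * ln (1 / (1 - \<delta>)) \<le> 2 * rate n * ln (1 / (1 - \<delta>))"
        using r p by (intro mult_right_mono) (auto simp: m_def)
      then show "exp (real (2 * m) * ln (1 / (1 - \<delta>))) \<le> exp (2 * rate n * ln (1 / (1 - \<delta>)))"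
        by (subst exp_le_cancel_iff)
    qed (use n_le in auto)
    also have "\<dots> = B"
      by (simp add: B_def exp_add[symmetric] algebra_simps)
    finally show ?thesis .
  qed
  have holo: "f holomorphic_on ball 0 1"
    unfolding f_def by (intro holomorphic_intros start_sum_holomorphic)
  obtain u where u: "norm u \<le> 1/2"
    "norm (f 0) ^ J \<le> norm (f (of_real \<delta> + of_real (1 - \<delta>) * u)) * B ^ (J - 1)"
    using large_value_in_disc[OF holo \<delta> J B] by blast
  have "1 \<le> B"
    using r p by (simp add: B_def)
  have "\<epsilon> ^ J \<le> norm (f 0) ^ J"
    using \<open>\<epsilon> \<le> norm (f 0)\<close> by (intro power_mono) (auto simp: \<epsilon>_def)
  also note u(2)
  also have "norm (f (of_real \<delta> + of_real (1 - \<delta>) * u)) * B ^ (J - 1) \<le> norm (f (of_real \<delta> + of_real (1 - \<delta>) * u)) * B ^ J"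
    using \<open>1 \<le> B\<close> by (intro mult_left_mono power_increasing) auto
  finally have "\<epsilon> ^ J / B ^ J \<le> norm (f (of_real \<delta> + of_real (1 - \<delta>) * u))"
    using \<open>1 \<le> B\<close> by (subst pos_divide_le_eq) auto
  moreover have "\<epsilon> ^ J / B ^ J = exp (- (real J * (350 + 2 * ln (1 / (1 - \<delta>))) * rate n))"
    by (simp add: \<epsilon>_def B_def exp_of_nat_mult[symmetric] exp_diff[symmetric] algebra_simps)
  ultimately have final: "exp (- (real J * (350 + 2 * ln (1 / (1 - \<delta>))) * rate n)) \<le> norm (f (of_real \<delta> + of_real (1 - \<delta>) * u))"
    by simp
  define v where "v = 1 - (1 - z) / of_real (1 - \<delta>)"
  have "complex_of_real (1 - \<delta>) \<noteq> 0"
    using \<delta> by (simp del: of_real_diff)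
  then have "of_real (1 - \<delta>) * v = of_real (1 - \<delta>) - (1 - z)"
    unfolding v_def right_diff_distrib by (simp del: of_real_diff)
  then have v: "of_real \<delta> + of_real (1 - \<delta>) * v = z"
    by simp
  have "norm v ^ j \<le> exp (28224 / (1 - \<delta>)\<^sup>2 * rate n)" if "j < n" for j
  proof -
    have "norm v ^ j \<le> exp (real n * (W\<^sup>2 / (1 - \<delta>)\<^sup>2))"
      using that by (intro norm_weight_power_le[OF p(1) z v_def]) auto
    also have "real n * (W\<^sup>2 / (1 - \<delta>)\<^sup>2) = real n * W\<^sup>2 / (1 - \<delta>)\<^sup>2"
      by simp
    also have "\<dots> \<le> 28224 * rate n / (1 - \<delta>)\<^sup>2"
      using ex(2) by (intro divide_right_mono) (auto simp: W_def)
    finally show ?thesis by simp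
  qed
  then show ?thesis
    using w u(1) final unfolding f_def m_def by (intro exI[of _ w] exI[of _ u] exI[of _ v]) (auto simp: v simp del: of_real_diff)
qed

lemma distinguishing_statistic:
  assumes \<delta>: "0 < \<delta>" "\<delta> < 1"
  shows "\<exists>C\<ge>0. \<forall>n x x'. 0 < n \<longrightarrow> length x = n \<longrightarrow> length x' = n \<longrightarrow> x \<noteq> x' \<longrightarrow>
    (\<exists>w u v V \<epsilon>. w \<noteq> [] \<and> length w \<le> 2 * block n \<and> norm u \<le> 1/2 \<and> (\<forall>j<n. norm v ^ j \<le> V) \<and> 0 < V \<and>
      \<epsilon> \<le> norm (start_sum (of_real \<delta> + of_real (1 - \<delta>) * v) (of_real \<delta> + of_real (1 - \<delta>) * u) w x -
        start_sum (of_real \<delta> + of_real (1 - \<delta>) * v) (of_real \<delta> + of_real (1 - \<delta>) * u) w x') \<and>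
      exp (- (C * rate n)) \<le> (1 - \<delta>) ^ length w * \<epsilon> / (real n * V))"
proof -
  define J where "J = nat \<lceil>4 * pi / (1 - \<delta>)\<rceil>"
  have J: "4 * pi / (1 - \<delta>) \<le> real J"
    unfolding J_def by linarith
  define a where "a = ln (1 / (1 - \<delta>))"
  define b where "b = ln (1 / \<delta>)"
  have ab: "0 \<le> a" "0 \<le> b"
    using \<delta> by (auto simp: a_def b_def intro!: ln_ge_zero)
  have p_exp: "1 - \<delta> = exp (- a)" and \<delta>_exp: "\<delta> = exp (- b)"
    using \<delta> by (auto simp: a_def b_def ln_div)
  \<comment> \<open>In \<open>C1\<close>: \<open>a\<close> pays for one factor
    \<open>1 - \<delta>\<close>, \<open>2 * b\<close> for \<open>\<delta> ^ i\<close> with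
    \<open>i < 2 * block n\<close>, \<open>real J\<close> for the power of \<open>n\<close>, and 1
    for the division by \<open>n\<close>. In \<open>C2\<close>: the \<open>2 * block n\<close>
    factors \<open>1 - \<delta>\<close>, the exponent of \<open>\<epsilon>\<close>, the division by
    \<open>n\<close>, and the exponent of \<open>V\<close>.\<close>
  define C1 where "C1 = a + 2 * b + real J + 1"
  define C2 where "C2 = 2 * a + real J * (350 + 2 * a) + 1 + 28224 / (1 - \<delta>)\<^sup>2"
  define C where "C = C1 + C2"
  have C12: "0 \<le> C1" "0 \<le> C2"
    using ab by (auto simp: C1_def C2_def)
  show ?thesis
  proof (intro exI[of _ C] conjI allI impI)
    show "0 \<le> C"
      using C12 by (simp add: C_def)
    fix n :: nat and x x' :: "bool list"
    assume n: "0 < n" and x: "length x = n" "length x' = n" "x \<noteq> x'"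
    obtain i where i: "i < n" "x ! i \<noteq> x' ! i" "\<And>k. k < i \<Longrightarrow> x ! k = x' ! k"
      using first_difference[of x x'] x by metis
    note r = rate_bounds[OF n] and mb = block_bounds[OF n]
    have n_le: "real n \<le> exp (ln (real n + 2))"
      by simp
    have C_le: "exp (- (C * rate n)) \<le> exp (- (C1 * rate n))" "exp (- (C * rate n)) \<le> exp (- (C2 * rate n))"
      using C12 r by (auto simp: C_def algebra_simps)
    show "\<exists>w u v V \<epsilon>. w \<noteq> [] \<and> length w \<le> 2 * block n \<and> norm u \<le> 1/2 \<and> (\<forall>j<n. norm v ^ j \<le> V) \<and> 0 < V \<and>
      \<epsilon> \<le> norm (start_sum (of_real \<delta> + of_real (1 - \<delta>) * v) (of_real \<delta> + of_real (1 - \<delta>) * u) w x -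
        start_sum (of_real \<delta> + of_real (1 - \<delta>) * v) (of_real \<delta> + of_real (1 - \<delta>) * u) w x') \<and>
      exp (- (C * rate n)) \<le> (1 - \<delta>) ^ length w * \<epsilon> / (real n * V)"
    proof (cases "2 * block n - 1 \<le> i")
      case False
      define \<epsilon> where "\<epsilon> = exp (- (2 * b + real J) * rate n)"
      obtain v where v: "norm v \<le> 1/2"
        "\<delta> ^ i \<le> norm (start_sum (of_real \<delta> + of_real (1 - \<delta>) * v) (of_real \<delta> + of_real (1 - \<delta>) * 0) [True] x -
          start_sum (of_real \<delta> + of_real (1 - \<delta>) * v) (of_real \<delta> + of_real (1 - \<delta>) * 0) [True] x') * real n ^ (J - 1)"
        (is "_ \<le> ?N * _")
        using bit_statistic_difference[OF \<delta> J x(1,2) i] by blast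
      have "\<epsilon> \<le> ?N"
      proof -
        have "exp (- (2 * b * rate n)) \<le> exp (- (real i * b))"
        proof -
          have "real i \<le> 2 * rate n"
            using False r(2) by linarith
          then have "real i * b \<le> 2 * rate n * b"
            using ab by (intro mult_right_mono) auto
          then show ?thesis
            by (simp add: mult_ac)
        qed
        also have "\<dots> = \<delta> ^ i"
          unfolding \<delta>_exp exp_of_nat_mult[symmetric] by simp
        also have "\<dots> \<le> ?N * real n ^ (J - 1)"
          by (rule v(2))
        also have "\<dots> \<le> ?N * exp (real J * rate n)"
        proof (rule mult_left_mono)
          have "real n ^ (J - 1) \<le> real n ^ J"
            using n by (intro power_increasing) auto
          also have "\<dots> \<le> exp (ln (real n + 2)) ^ J"
            using n_le by (intro power_mono) auto
          also have "\<dots> \<le> exp (rate n) ^ J"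
            using r(3) by (intro power_mono) (auto simp del: exp_ln)
          finally show "real n ^ (J - 1) \<le> exp (real J * rate n)"
            by (simp add: exp_of_nat_mult)
        qed auto
        finally have "exp (- (2 * b * rate n)) / exp (real J * rate n) \<le> ?N"
          by (subst pos_divide_le_eq) auto
        moreover have "exp (- (2 * b * rate n)) / exp (real J * rate n) = \<epsilon>"
          unfolding \<epsilon>_def exp_diff[symmetric] by (simp add: algebra_simps)
        ultimately show ?thesis
          by (simp only:)
      qed
      moreover have "exp (- (C * rate n)) \<le> (1 - \<delta>) ^ length [True] * \<epsilon> / (real n * 1)"
      proof -
        have "exp (- (C1 * rate n)) \<le> exp (- a) * \<epsilon> * exp (- ln (real n + 2))"
        proof -
          have "a * 1 \<le> a * rate n"
            using r ab by (intro mult_left_mono) auto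
          then have "a + (2 * b + real J) * rate n + ln (real n + 2) \<le> C1 * rate n"
            using r by (simp add: C1_def algebra_simps)
          then show ?thesis
            unfolding \<epsilon>_def exp_add[symmetric] by (subst exp_le_cancel_iff) (simp add: algebra_simps)
        qed
        also have "\<dots> = exp (- a) * \<epsilon> / exp (ln (real n + 2))"
          by (simp only: exp_minus divide_inverse)
        also have "\<dots> \<le> exp (- a) * \<epsilon> / real n"
          using n by (intro divide_left_mono) (auto simp: \<epsilon>_def)
        finally have "exp (- (C * rate n)) \<le> exp (- a) * \<epsilon> / real n"
          using C_le(1) by linarith
        then show ?thesis
          by (simp add: p_exp)
      qed
      moreover have "\<forall>j<n. norm v ^ j \<le> 1"
        using v(1) by (auto intro!: power_le_one)
      moreover have "length [True] \<le> 2 * block n"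
        using mb by simp
      ultimately show ?thesis
        by (intro exI[of _ "[True]"] exI[of _ 0] exI[of _ v] exI[of _ 1] exI[of _ \<epsilon>]) auto
    next
      case True
      define \<epsilon> where "\<epsilon> = exp (- (real J * (350 + 2 * a) * rate n))"
      define V where "V = exp (28224 / (1 - \<delta>)\<^sup>2 * rate n)"
      obtain w u v where w: "length w = 2 * block n" and u: "norm u \<le> 1/2" and v: "\<forall>j<n. norm v ^ j \<le> V"
        and gap: "\<epsilon> \<le> norm (start_sum (of_real \<delta> + of_real (1 - \<delta>) * v) (of_real \<delta> + of_real (1 - \<delta>) * u) w x -
          start_sum (of_real \<delta> + of_real (1 - \<delta>) * v) (of_real \<delta> + of_real (1 - \<delta>) * u) w x')"
        using late_statistic[OF \<delta> J x(1,2) i True] unfolding \<epsilon>_def V_def a_def by blast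
      have "exp (- (C * rate n)) \<le> (1 - \<delta>) ^ length w * \<epsilon> / (real n * V)"
      proof -
        have pw: "(1 - \<delta>) ^ length w = exp (- (2 * real (block n) * a))"
          unfolding p_exp exp_of_nat_mult[symmetric] w by simp
        have "real (block n) * a \<le> rate n * a"
          using r ab by (intro mult_right_mono) auto
        then have "2 * real (block n) * a + real J * (350 + 2 * a) * rate n + ln (real n + 2) + 28224 / (1 - \<delta>)\<^sup>2 * rate n \<le> C2 * rate n"
          using r by (simp add: C2_def algebra_simps)
        then have "exp (- (C2 * rate n)) \<le> exp (- (2 * real (block n) * a)) * \<epsilon> * exp (- ln (real n + 2)) * exp (- (28224 / (1 - \<delta>)\<^sup>2 * rate n))"
          unfolding \<epsilon>_def exp_add[symmetric] by (subst exp_le_cancel_iff) linarith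
        also have "\<dots> = (1 - \<delta>) ^ length w * \<epsilon> / (exp (ln (real n + 2)) * V)"
          unfolding pw V_def by (simp only: exp_minus divide_inverse inverse_mult_distrib mult.assoc)
        also have "\<dots> \<le> (1 - \<delta>) ^ length w * \<epsilon> / (real n * V)"
          using n \<delta> by (intro divide_left_mono mult_right_mono) (auto simp: \<epsilon>_def V_def)
        finally show ?thesis
          using C_le by linarith
      qed
      moreover have "w \<noteq> []"
        using w mb by auto
      moreover have "0 < V"
        by (simp add: V_def)
      ultimately show ?thesis
        using w u v gap by (intro exI[of _ w] exI[of _ u] exI[of _ v] exI[of _ V] exI[of _ \<epsilon>]) auto
    qed
  qed
qed

lemma distinguishing_local_query:
  assumes \<delta>: "0 < \<delta>" "\<delta> < 1"
  shows "\<exists>C\<ge>0. \<forall>n x x'. length x = n \<longrightarrow> length x' = n \<longrightarrow> x \<noteq> x' \<longrightarrow>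
    (\<exists>q. local_query n (min n (Suc (nat \<lceil>C * rate n\<rceil>))) q \<and>
      exp (- (C * rate n)) \<le> \<bar>measure_pmf.expectation (Del \<delta> x) q - measure_pmf.expectation (Del \<delta> x') q\<bar>)"
proof -
  obtain C0 where "C0 \<ge> 0" and stat: "\<And>n x x'. 0 < n \<Longrightarrow> length x = n \<Longrightarrow> length x' = n \<Longrightarrow> x \<noteq> x' \<Longrightarrow>
    (\<exists>w u v V \<epsilon>. w \<noteq> [] \<and> length w \<le> 2 * block n \<and> norm u \<le> 1/2 \<and> (\<forall>j<n. norm v ^ j \<le> V) \<and> 0 < V \<and>
      \<epsilon> \<le> norm (start_sum (of_real \<delta> + of_real (1 - \<delta>) * v) (of_real \<delta> + of_real (1 - \<delta>) * u) w x -
        start_sum (of_real \<delta> + of_real (1 - \<delta>) * v) (of_real \<delta> + of_real (1 - \<delta>) * u) w x') \<and>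
      exp (- (C0 * rate n)) \<le> (1 - \<delta>) ^ length w * \<epsilon> / (real n * V))"
    using distinguishing_statistic[OF \<delta>] by metis
  \<comment> \<open>The 4 compensates \<open>3/4 \<le> exp (- (1/4))\<close>; the 7 covers 3 for the
    factor 8 and 4 for \<open>4 ^ length w\<close>. The scaling factor
    \<open>4 * 2 ^ length w\<close> of the query is absorbed as well.\<close>
  define C where "C = 4 * (7 + C0)"
  have exp1: "(2::real) \<le> exp 1"
    using exp_ge_add_one_self[of "1::real"] by simp
  have exp2: "(4::real) \<le> exp 2"
    using mult_mono[OF exp1 exp1] by (simp add: exp_add[symmetric])
  have exp3: "(8::real) \<le> exp 3"
    using mult_mono[OF exp1 exp2] by (simp add: exp_add[symmetric])
  show ?thesis
  proof (intro exI[of _ C] conjI allI impI)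
    show "0 \<le> C"
      using \<open>C0 \<ge> 0\<close> by (simp add: C_def)
    fix n :: nat and x x' :: "bool list"
    assume x: "length x = n" "length x' = n" "x \<noteq> x'"
    then have n: "0 < n" by auto
    note r = rate_bounds[OF n]
    define L where "L = nat \<lceil>C * rate n\<rceil>"
    obtain w u v V \<epsilon> where w: "w \<noteq> []" "length w \<le> 2 * block n" and u: "norm u \<le> 1/2"
      and V: "\<And>j. j < n \<Longrightarrow> norm v ^ j \<le> V" "0 < V"
      and gap: "\<epsilon> \<le> norm (start_sum (of_real \<delta> + of_real (1 - \<delta>) * v) (of_real \<delta> + of_real (1 - \<delta>) * u) w x -
        start_sum (of_real \<delta> + of_real (1 - \<delta>) * v) (of_real \<delta> + of_real (1 - \<delta>) * u) w x')"
      and D: "exp (- (C0 * rate n)) \<le> (1 - \<delta>) ^ length w * \<epsilon> / (real n * V)"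
      using stat[OF n x] by blast
    have w_le: "real (length w) \<le> 2 * rate n"
      using w(2) r(2) by linarith
    have "2 * (3/4) ^ L * 4 ^ length w \<le> (1 - \<delta>) ^ length w * \<epsilon> / (real n * V) / 4"
    proof -
      have "(3/4::real) ^ L \<le> exp (- (1/4)) ^ L"
        using exp_ge_add_one_self[of "-(1/4)::real"] by (intro power_mono) auto
      also have "\<dots> = exp (- (real L / 4))"
        by (simp add: exp_of_nat_mult[symmetric])
      finally have q: "(3/4::real) ^ L \<le> exp (- (real L / 4))" .
      have "(4::real) ^ length w \<le> exp 2 ^ length w"
        using exp2 by (intro power_mono) auto
      also have "\<dots> = exp (2 * real (length w))"
        by (simp add: exp_of_nat_mult[symmetric] mult.commute)
      also have "\<dots> \<le> exp (4 * rate n)"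
        using w_le by simp
      finally have "8 * (3/4::real) ^ L * 4 ^ length w \<le> exp 3 * exp (- (real L / 4)) * exp (4 * rate n)"
        using q exp3 by (intro mult_mono) auto
      also have "\<dots> = exp (3 - real L / 4 + 4 * rate n)"
        by (simp add: exp_add[symmetric])
      also have "\<dots> \<le> exp (- (C0 * rate n))"
      proof -
        have "C * rate n \<le> real L"
          unfolding L_def by linarith
        then show ?thesis
          using r by (simp add: C_def algebra_simps)
      qed
      also note D
      finally have "8 * (3/4) ^ L * 4 ^ length w \<le> (1 - \<delta>) ^ length w * \<epsilon> / (real n * V)" .
      moreover have "2 * s * t \<le> X / 4" if "8 * s * t \<le> X" for s t X :: real
        using that by linarith
      ultimately show ?thesis
        by blast
    qed
    from distinguishing_query[OF \<delta> x(1,2) n w(1) u V gap refl this]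
    obtain q where q: "local_query n (min n (Suc L)) q"
      "(1 - \<delta>) ^ length w * \<epsilon> / (real n * V) / (4 * 2 ^ length w) \<le>
        \<bar>measure_pmf.expectation (Del \<delta> x) q - measure_pmf.expectation (Del \<delta> x') q\<bar>"
      by blast
    have "exp (- (C * rate n)) \<le> exp (- (C0 * rate n)) / exp (2 + 2 * rate n)"
      using r(1) mult_nonneg_nonneg[OF \<open>C0 \<ge> 0\<close>, of "rate n * 3"]
      by (simp add: exp_diff[symmetric] C_def algebra_simps)
    also have "\<dots> \<le> (1 - \<delta>) ^ length w * \<epsilon> / (real n * V) / (4 * 2 ^ length w)"
    proof (rule frac_le[OF _ D])
      have "(2::real) ^ length w \<le> exp 1 ^ length w"
        using exp1 by (intro power_mono) auto
      also have "\<dots> = exp (real (length w))"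
        by (simp add: exp_of_nat_mult[symmetric])
      also have "\<dots> \<le> exp (2 * rate n)"
        using w_le by simp
      finally show "4 * 2 ^ length w \<le> exp (2 + 2 * rate n)"
        unfolding exp_add using exp2 by (intro mult_mono) auto
    qed (use D less_le_trans[OF exp_gt_zero D] in auto)
    finally have "exp (- (C * rate n)) \<le> (1 - \<delta>) ^ length w * \<epsilon> / (real n * V) / (4 * 2 ^ length w)" .
    with q show "\<exists>q. local_query n (min n (Suc (nat \<lceil>C * rate n\<rceil>))) q \<and>
      exp (- (C * rate n)) \<le> \<bar>measure_pmf.expectation (Del \<delta> x) q - measure_pmf.expectation (Del \<delta> x') q\<bar>"
      unfolding L_def by (intro exI[of _ q]) linarith
  qed
qed

section \<open>From distinguishing queries to an algorithm\<close>

primrec ask :: "(bool list \<Rightarrow> real) list \<Rightarrow> real \<Rightarrow> (real list \<Rightarrow> bool list) \<Rightarrow> sq_alg" where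
  "ask [] \<tau> g = Output (g [])"
| "ask (q # qs) \<tau> g = Query q \<tau> (\<lambda>v. ask qs \<tau> (\<lambda>vs. g (v # vs)))"

lemma all_queries_ask: "all_queries P (ask qs \<tau> g) \<longleftrightarrow> (\<forall>q\<in>set qs. P q \<tau>)"
  by (induction qs arbitrary: g) auto

lemma sq_run_ask:
  assumes "sq_run \<delta> x (ask qs \<tau> g) z"
  shows "\<exists>vs. list_all2 (\<lambda>q v. sq_response \<delta> x q \<tau> v) qs vs \<and> z = g vs"
  using assms
proof (induction qs arbitrary: g)
  case Nil
  then show ?case
    by (auto elim: sq_run.cases)
next
  case (Cons q qs)
  from Cons.prems obtain v where v: "sq_response \<delta> x q \<tau> v" "sq_run \<delta> x (ask qs \<tau> (\<lambda>vs. g (v # vs))) z"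
    by (auto elim: sq_run.cases)
  from Cons.IH[OF v(2)] obtain vs where "list_all2 (\<lambda>q v. sq_response \<delta> x q \<tau> v) qs vs" "z = g (v # vs)"
    by blast
  with v(1) show ?case
    by (intro exI[of _ "v # vs"]) simp
qed

text \<open>All queries for pairs of strings are asked without adaptivity. A wrong string consistent
  with the responses would share, with the source, a response to the query for that very pair, so
  the two expectations would differ by at most \<open>2 * \<tau>\<close>.\<close>

lemma sq_algorithm_from_distinguishers:
  assumes \<tau>: "0 < \<tau>" "\<tau> < 1"
    and sep: "\<And>x x'. length x = n \<Longrightarrow> length x' = n \<Longrightarrow> x \<noteq> x' \<Longrightarrow>
      \<exists>q. local_query n l q \<and> 2 * \<tau> < \<bar>measure_pmf.expectation (Del \<delta> x) q - measure_pmf.expectation (Del \<delta> x') q\<bar>"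
  shows "\<exists>A. sq_algorithm n A \<and> all_queries (\<lambda>q t. local_query n l q \<and> t = \<tau>) A \<and> solves_worst_case \<delta> n A"
proof -
  obtain Q where Q: "\<And>x x'. length x = n \<Longrightarrow> length x' = n \<Longrightarrow> x \<noteq> x' \<Longrightarrow>
      local_query n l (Q x x') \<and> 2 * \<tau> < \<bar>measure_pmf.expectation (Del \<delta> x) (Q x x') - measure_pmf.expectation (Del \<delta> x') (Q x x')\<bar>"
    using sep by metis
  define S where "S = {(x, x'). length x = n \<and> length x' = n \<and> x \<noteq> (x' :: bool list)}"
  have "finite {xs :: bool list. set xs \<subseteq> UNIV \<and> length xs = n}"
    by (rule finite_lists_length_eq) simp
  then have "finite ({xs :: bool list. length xs = n} \<times> {xs :: bool list. length xs = n})"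
    by simp
  then have "finite S"
    by (rule finite_subset[rotated]) (auto simp: S_def)
  then obtain ps where ps: "set ps = S"
    using finite_list by blast
  define qs where "qs = map (\<lambda>(x, x'). Q x x') ps"
  define consistent where "consistent vs x \<longleftrightarrow> length x = n \<and> list_all2 (\<lambda>q v. sq_response \<delta> x q \<tau> v) qs vs" for vs x
  \<comment> \<open>The source is consistent with every valid list of responses, so
    \<open>SOME\<close> then returns a consistent string.\<close>
  define A where "A = ask qs \<tau> (\<lambda>vs. SOME x. consistent vs x)"
  have local: "local_query n l q" if "q \<in> set qs" for q
    using that Q by (auto simp: qs_def ps S_def)
  have range: "q y \<in> {-1..1}" if q: "local_query n l q" and y: "length y = n" for q y
  proof -
    obtain i q' where "i + l \<le> n" "\<forall>z. length z = l \<longrightarrow> q' z \<in> {-1..1}" "q y = q' (take l (drop i y))"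
      using q y unfolding local_query_def by blast
    then show ?thesis
      using y by simp
  qed
  have "sq_algorithm n A"
    unfolding sq_algorithm_def A_def all_queries_ask using \<tau> local range by auto
  moreover have "all_queries (\<lambda>q t. local_query n l q \<and> t = \<tau>) A"
    unfolding A_def all_queries_ask using local by auto
  moreover have "z = x" if x: "length x = n" and run: "sq_run \<delta> x A z" for x z
  proof (rule ccontr)
    assume "z \<noteq> x"
    obtain vs where vs: "list_all2 (\<lambda>q v. sq_response \<delta> x q \<tau> v) qs vs" "z = (SOME x. consistent vs x)"
      using sq_run_ask[OF run[unfolded A_def]] by blast
    have "consistent vs x"
      using x vs(1) by (simp add: consistent_def)
    then have "consistent vs z"
      unfolding vs(2) by (rule someI)
    then have z: "length z = n" "list_all2 (\<lambda>q v. sq_response \<delta> z q \<tau> v) qs vs"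
      by (auto simp: consistent_def)
    have "Q x z \<in> set qs"
      using x z(1) \<open>z \<noteq> x\<close> by (force simp: qs_def ps S_def)
    then obtain k where k: "k < length qs" "qs ! k = Q x z"
      by (auto simp: in_set_conv_nth)
    have "sq_response \<delta> x (Q x z) \<tau> (vs ! k)" "sq_response \<delta> z (Q x z) \<tau> (vs ! k)"
      using list_all2_nthD[OF vs(1) k(1)] list_all2_nthD[OF z(2) k(1)] k(2) by simp_all
    then have "\<bar>measure_pmf.expectation (Del \<delta> x) (Q x z) - measure_pmf.expectation (Del \<delta> z) (Q x z)\<bar> \<le> 2 * \<tau>"
      unfolding sq_response_def by linarith
    then show False
      using Q[OF x z(1)] \<open>z \<noteq> x\<close> by force
  qed
  then have "solves_worst_case \<delta> n A"
    unfolding solves_worst_case_def by blast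
  ultimately show ?thesis
    by blast
qed

text \<open>\<open>rate\<close> carries only the square of the logarithm, below the fifth power
  allowed; the ceiling in \<open>block\<close> is first replaced by an added 1.\<close>

lemma rate_bigo:
  assumes "0 \<le> C" "0 \<le> c"
  shows "(\<lambda>n. C * rate n + c) \<in> O(\<lambda>n. real n powr (1/5) * log 2 (real n) ^ 5)"
proof -
  have "(\<lambda>n. C * rate n + c) \<in> O(\<lambda>n. C * ((real n powr (1/5) + 1) * (ln (real n + 2))\<^sup>2) + c)"
  proof (intro landau_o.big_mono always_eventually allI)
    fix n
    have "rate n \<le> (real n powr (1/5) + 1) * (ln (real n + 2))\<^sup>2"
      unfolding rate_def using block_le by (intro mult_right_mono) auto
    moreover have "0 \<le> rate n"
      by (simp add: rate_def)
    ultimately show "norm (C * rate n + c) \<le> norm (C * ((real n powr (1/5) + 1) * (ln (real n + 2))\<^sup>2) + c)"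
      using assms by (simp add: mult_left_mono)
  qed
  also have "(\<lambda>n::nat. C * ((real n powr (1/5) + 1) * (ln (real n + 2))\<^sup>2) + c) \<in> O(\<lambda>n. real n powr (1/5) * log 2 (real n) ^ 5)"
    unfolding log_def by real_asymp
  finally show ?thesis .
qed

theorem theorem4p1:
  fixes \<delta> :: real
  assumes "0 < \<delta>" and "\<delta> < 1"
  shows "\<exists>(l :: nat \<Rightarrow> nat) (e :: nat \<Rightarrow> real) (A :: nat \<Rightarrow> sq_alg).
           (\<lambda>n. real (l n)) \<in> O(\<lambda>n. real n powr (1/5) * log 2 (real n) ^ 5) \<and>
           e \<in> O(\<lambda>n. real n powr (1/5) * log 2 (real n) ^ 5) \<and>
           (\<forall>n. sq_algorithm n (A n) \<and>
                all_queries (\<lambda>q \<tau>. local_query n (l n) q \<and> \<tau> = 2 powr (- e n)) (A n) \<and>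
                solves_worst_case \<delta> n (A n))"
proof -
  obtain C where "C \<ge> 0" and C: "\<And>n x x'. length x = n \<Longrightarrow> length x' = n \<Longrightarrow> x \<noteq> x' \<Longrightarrow>
    \<exists>q. local_query n (min n (Suc (nat \<lceil>C * rate n\<rceil>))) q \<and>
      exp (- (C * rate n)) \<le> \<bar>measure_pmf.expectation (Del \<delta> x) q - measure_pmf.expectation (Del \<delta> x') q\<bar>"
    using distinguishing_local_query[OF assms] by metis
  define l where "l n = min n (Suc (nat \<lceil>C * rate n\<rceil>))" for n
  \<comment> \<open>Division by ln 2 changes the base from e to 2. The summand 2 makes twice the
    tolerance smaller than the separation, as exp 2 exceeds 2, and keeps the tolerance below 1 for
    \<open>n = 0\<close>.\<close>
  define e where "e n = (C * rate n + 2) / ln 2" for n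
  have rate_nonneg: "0 \<le> C * rate n" for n
    using \<open>C \<ge> 0\<close> by (simp add: rate_def)
  have \<tau>: "2 powr (- e n) = exp (- (C * rate n + 2))" for n
    by (simp add: powr_def e_def)
  have "\<exists>A. sq_algorithm n A \<and> all_queries (\<lambda>q t. local_query n (l n) q \<and> t = 2 powr (- e n)) A \<and> solves_worst_case \<delta> n A" for n
  proof (rule sq_algorithm_from_distinguishers)
    show "0 < 2 powr (- e n)" "2 powr (- e n) < 1"
      unfolding \<tau> using rate_nonneg[of n] by auto
    fix x x' :: "bool list"
    assume x: "length x = n" "length x' = n" "x \<noteq> x'"
    have "2 * 2 powr (- e n) < exp (- (C * rate n))"
    proof -
      have "(2::real) < exp 2"
        using exp_ge_add_one_self[of "2::real"] by simp
      then have "2 * exp (- (C * rate n + 2)) < exp 2 * exp (- (C * rate n + 2))"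
        by (intro mult_strict_right_mono) auto
      then show ?thesis
        by (simp add: \<tau> exp_add[symmetric])
    qed
    then show "\<exists>q. local_query n (l n) q \<and>
        2 * 2 powr (- e n) < \<bar>measure_pmf.expectation (Del \<delta> x) q - measure_pmf.expectation (Del \<delta> x') q\<bar>"
      using C[OF x] unfolding l_def by force
  qed
  then obtain A where A: "\<And>n. sq_algorithm n (A n) \<and>
      all_queries (\<lambda>q t. local_query n (l n) q \<and> t = 2 powr (- e n)) (A n) \<and> solves_worst_case \<delta> n (A n)"
    by metis
  have "(\<lambda>n. real (l n)) \<in> O(\<lambda>n. C * rate n + 2)"
  proof (intro landau_o.big_mono always_eventually allI)
    \<comment> \<open>The ceiling and \<open>Suc\<close> add at most 2.\<close>
    show "norm (real (l n)) \<le> norm (C * rate n + 2)" for n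
      using rate_nonneg[of n] unfolding l_def by (simp add: min_def) linarith
  qed
  also have "(\<lambda>n. C * rate n + 2) \<in> O(\<lambda>n. real n powr (1/5) * log 2 (real n) ^ 5)"
    using \<open>C \<ge> 0\<close> by (intro rate_bigo) auto
  finally have "(\<lambda>n. real (l n)) \<in> O(\<lambda>n. real n powr (1/5) * log 2 (real n) ^ 5)" .
  moreover have "(\<lambda>n. C / ln 2 * rate n + 2 / ln 2) \<in> O(\<lambda>n. real n powr (1/5) * log 2 (real n) ^ 5)"
    using \<open>C \<ge> 0\<close> by (intro rate_bigo) auto
  then have "e \<in> O(\<lambda>n. real n powr (1/5) * log 2 (real n) ^ 5)"
    by (simp add: e_def[abs_def] add_divide_distrib)
  ultimately show ?thesis
    using A by blast
qed

end
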